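(* Let $G$ be a locally compact group and $\omega$ a weight on $G$ which is bounded away from $0$. If $L^1(G,\omega)$ is pseudo-amenable, then $G$ is amenable.
   Context: A weight on $G$ is a continuous function $\omega:G\to(0,\infty)$ with $\omega(st)\le\omega(s)\omega(t)$. $L^1(G,\omega)$ is the Banach algebra under convolution of measurable $f$ with $\int|f|\omega<\infty$ (left Haar measure). For a Banach algebra $\mathcal{A}$ with $\pi(a\otimes b)=ab$, an approximate diagonal is a net $(m_i)$ in $\mathcal{A}\hat{\otimes}\mathcal{A}$ with $a\cdot m_i-m_i\cdot a\to0$ and $a\pi(m_i)\to a$ for all $a\in\mathcal{A}$ (module actions $c\cdot(a\otimes b)=ca\otimes b$, $(a\otimes b)\cdot c=a\otimes bc$); $\mathcal{A}$ is pseudo-amenable if it has an approximate diagonal. *)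

theory Defs
  imports "HOL-Analysis.Analysis"
begin

text \<open>Conventions. The locally compact group G is a type 'g of class
 topological_group_add (written additively; group_add is NOT assumed commutative),
 Hausdorff, and locally compact. Left Haar measure: a nonzero Radon measure on the
 Borel sets, left invariant. Elements of L1(G,w) are represented by functions
 (the norm is a seminorm; everything below is invariant under a.e. equality).\<close>

definition left_haar_measure :: "'g::{topological_group_add,t2_space} measure \<Rightarrow> bool" where
  "left_haar_measure M \<longleftrightarrow>
     sets M = sets borel \<and>
     (\<forall>K. compact K \<longrightarrow> emeasure M K < \<infinity>) \<and>
     (\<forall>U. open U \<and> U \<noteq> {} \<longrightarrow> emeasure M U > 0) \<and>
     (\<forall>g A. A \<in> sets borel \<longrightarrow> emeasure M ((\<lambda>x. g + x) ` A) = emeasure M A) \<and>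
     (\<forall>A \<in> sets borel. emeasure M A = (INF U \<in> {U. open U \<and> A \<subseteq> U}. emeasure M U)) \<and>
     (\<forall>U. open U \<longrightarrow> emeasure M U = (SUP K \<in> {K. compact K \<and> K \<subseteq> U}. emeasure M K))"

definition is_weight :: "('g::topological_group_add \<Rightarrow> real) \<Rightarrow> bool" where
  "is_weight w \<longleftrightarrow> continuous_on UNIV w \<and> (\<forall>x. w x > 0) \<and> (\<forall>s t. w (s + t) \<le> w s * w t)"

definition L1w :: "'g measure \<Rightarrow> ('g \<Rightarrow> real) \<Rightarrow> ('g \<Rightarrow> complex) set" where
  "L1w M w = {f. f \<in> borel_measurable M \<and> integrable M (\<lambda>x. cmod (f x) * w x)}"

definition wnorm :: "'g measure \<Rightarrow> ('g \<Rightarrow> real) \<Rightarrow> ('g \<Rightarrow> complex) \<Rightarrow> real" where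
  "wnorm M w f = (LINT x|M. cmod (f x) * w x)"

definition conv :: "'g::group_add measure \<Rightarrow> ('g \<Rightarrow> complex) \<Rightarrow> ('g \<Rightarrow> complex) \<Rightarrow> 'g \<Rightarrow> complex" where
  "conv M f g x = (LINT y|M. f y * g (- y + x))"

text \<open>Projective tensor product L1(G,w) hat-otimes L1(G,w). An element is represented by
 a sequence of pairs (a_n, b_n) in L1(G,w) with sum ||a_n|| ||b_n|| < infinity, standing for
 sum a_n (x) b_n. The projective tensor product is realised isometrically inside the dual of
 the space of bounded bilinear forms on L1(G,w) (its dual space), so the norm of an element u
 is the sup of |<u,B>| over bilinear forms B of norm at most 1.\<close>
definition tensor_rep :: "'g measure \<Rightarrow> ('g \<Rightarrow> real) \<Rightarrow> (nat \<Rightarrow> ('g \<Rightarrow> complex) \<times> ('g \<Rightarrow> complex)) \<Rightarrow> bool" where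
  "tensor_rep M w u \<longleftrightarrow> (\<forall>n. fst (u n) \<in> L1w M w \<and> snd (u n) \<in> L1w M w) \<and>
     summable (\<lambda>n. wnorm M w (fst (u n)) * wnorm M w (snd (u n)))"

definition bil_unit :: "'g measure \<Rightarrow> ('g \<Rightarrow> real) \<Rightarrow> (('g \<Rightarrow> complex) \<Rightarrow> ('g \<Rightarrow> complex) \<Rightarrow> complex) set" where
  "bil_unit M w = {B.
     (\<forall>f1\<in>L1w M w. \<forall>f2\<in>L1w M w. \<forall>g\<in>L1w M w. \<forall>c::complex.
        B (\<lambda>x. f1 x + c * f2 x) g = B f1 g + c * B f2 g \<and>
        B g (\<lambda>x. f1 x + c * f2 x) = B g f1 + c * B g f2) \<and>
     (\<forall>f\<in>L1w M w. \<forall>g\<in>L1w M w. cmod (B f g) \<le> wnorm M w f * wnorm M w g)}"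

definition tpair :: "(('g \<Rightarrow> complex) \<Rightarrow> ('g \<Rightarrow> complex) \<Rightarrow> complex) \<Rightarrow> (nat \<Rightarrow> ('g \<Rightarrow> complex) \<times> ('g \<Rightarrow> complex)) \<Rightarrow> complex" where
  "tpair B u = (\<Sum>n. B (fst (u n)) (snd (u n)))"

definition tdist :: "'g measure \<Rightarrow> ('g \<Rightarrow> real) \<Rightarrow> (nat \<Rightarrow> ('g \<Rightarrow> complex) \<times> ('g \<Rightarrow> complex))
     \<Rightarrow> (nat \<Rightarrow> ('g \<Rightarrow> complex) \<times> ('g \<Rightarrow> complex)) \<Rightarrow> real" where
  "tdist M w u v = Sup ((\<lambda>B. cmod (tpair B u - tpair B v)) ` bil_unit M w)"

definition lmod :: "'g::group_add measure \<Rightarrow> ('g \<Rightarrow> complex) \<Rightarrow> (nat \<Rightarrow> ('g \<Rightarrow> complex) \<times> ('g \<Rightarrow> complex))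
     \<Rightarrow> (nat \<Rightarrow> ('g \<Rightarrow> complex) \<times> ('g \<Rightarrow> complex))" where
  "lmod M c u = (\<lambda>n. (conv M c (fst (u n)), snd (u n)))"

definition rmod :: "'g::group_add measure \<Rightarrow> (nat \<Rightarrow> ('g \<Rightarrow> complex) \<times> ('g \<Rightarrow> complex)) \<Rightarrow> ('g \<Rightarrow> complex)
     \<Rightarrow> (nat \<Rightarrow> ('g \<Rightarrow> complex) \<times> ('g \<Rightarrow> complex))" where
  "rmod M u c = (\<lambda>n. (fst (u n), conv M (snd (u n)) c))"

text \<open>pi(sum a_n (x) b_n) = sum a_n * b_n; the series converges absolutely a.e. and in L1(G,w).\<close>
definition tpi :: "'g::group_add measure \<Rightarrow> (nat \<Rightarrow> ('g \<Rightarrow> complex) \<times> ('g \<Rightarrow> complex)) \<Rightarrow> 'g \<Rightarrow> complex" where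
  "tpi M u x = (\<Sum>n. conv M (fst (u n)) (snd (u n)) x)"

text \<open>An approximate diagonal for L1(G,w), indexed by a net given as a proper filter F.\<close>
definition approx_diagonal :: "'g::group_add measure \<Rightarrow> ('g \<Rightarrow> real) \<Rightarrow> 'i filter
     \<Rightarrow> ('i \<Rightarrow> nat \<Rightarrow> ('g \<Rightarrow> complex) \<times> ('g \<Rightarrow> complex)) \<Rightarrow> bool" where
  "approx_diagonal M w F m \<longleftrightarrow> F \<noteq> bot \<and> (\<forall>i. tensor_rep M w (m i)) \<and>
     (\<forall>a \<in> L1w M w.
        ((\<lambda>i. tdist M w (lmod M a (m i)) (rmod M (m i) a)) \<longlongrightarrow> 0) F \<and>
        ((\<lambda>i. wnorm M w (\<lambda>x. conv M a (tpi M (m i)) x - a x)) \<longlongrightarrow> 0) F)"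

definition Linf :: "'g measure \<Rightarrow> ('g \<Rightarrow> real) set" where
  "Linf M = {f. f \<in> borel_measurable M \<and> (\<exists>C. AE x in M. \<bar>f x\<bar> \<le> C)}"

definition amenable_group :: "'g::group_add measure \<Rightarrow> bool" where
  "amenable_group M \<longleftrightarrow> (\<exists>\<mu> :: ('g \<Rightarrow> real) \<Rightarrow> real.
     (\<forall>f\<in>Linf M. \<forall>g\<in>Linf M. \<forall>c::real. \<mu> (\<lambda>x. f x + c * g x) = \<mu> f + c * \<mu> g) \<and>
     (\<forall>f\<in>Linf M. (AE x in M. f x \<ge> 0) \<longrightarrow> \<mu> f \<ge> 0) \<and>
     \<mu> (\<lambda>x. 1) = 1 \<and>
     (\<forall>f\<in>Linf M. \<forall>s. \<mu> (\<lambda>x. f (s + x)) = \<mu> f))"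

end

theory Submission
  imports Defs
begin

text \<open>
  Since \<open>w\<close> is bounded away from \<open>0\<close>, integration is a bounded functional on \<open>L1(G,w)\<close> and \<open>L1(G,w)\<close>
  embeds into \<open>L1(G)\<close>. Applying \<open>id \<otimes> \<integral>\<close> to an approximate diagonal \<open>m i\<close> yields functions \<open>\<phi> i\<close>
  with \<open>a * \<phi> i - (\<integral>a) \<phi> i \<rightarrow> 0\<close> for all \<open>a\<close>, and \<open>\<integral>\<phi> i \<rightarrow> 1\<close> because \<open>a \<pi>(m i) \<rightarrow> a\<close>. Using this for some
  \<open>a\<close> of integral \<open>1\<close> and for its left translates gives \<open>\<delta>\<^sub>s * \<phi> i - \<phi> i \<rightarrow> 0\<close> in \<open>L1(G)\<close>. The norms of the \<open>\<phi> i\<close>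
  may be unbounded but stay away from \<open>0\<close>, so \<open>\<bar>\<phi> i\<bar> / \<parallel>\<phi> i\<parallel>\<close> is a net of almost invariant probability
  densities, and any weak* cluster point is an invariant mean.
\<close>

text \<open>Distances in the tensor product are suprema over bilinear forms, so
  \<open>id \<otimes> \<integral>\<close> is computed on representing series only and is estimated
  by testing \<open>tdist\<close> on forms that send \<open>(f, g)\<close> to \<open>c^2\<close>
  times the integral of \<open>f * h\<close> times the integral of \<open>g\<close>, with
  \<open>h\<close> a phase. The factor \<open>c^2\<close> is there because both functionals have
  norm at most \<open>1 / c\<close>. Right multiplication by \<open>a\<close> turns into the scalar
  "integral of a" because the integral is multiplicative on convolutions. This Fubini identity is
  the main obstacle: it is obtained on compact sets from left invariance and then spread by
  regularity. Translates help because (delta_s * p) * phi = delta_s * (p * phi), where p and delta_s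
  * p both have integral 1. Hence phi and delta_s * phi are both close to delta_s * (p * phi). The
  comparison is made in the unweighted L1(G), where left translation is an isometry. The norms stay
  away from 0 since they dominate the modulus of the integrals, which tends to 1.\<close>

text \<open>A form of the tube lemma. Applied to maps such as \<open>- y + x\<close>, it keeps a
  compact set of \<open>y\<close> inside an open condition while \<open>x\<close> moves; this is how
  continuity of the group operations enters the slice arguments.\<close>

lemma open_forall_compact:
  fixes f :: "'a::topological_space \<Rightarrow> 'b::topological_space \<Rightarrow> 'c::topological_space"
  assumes f: "continuous_on UNIV (\<lambda>p. f (fst p) (snd p))" and K: "compact K" and U: "open U"
  shows "open {x. \<forall>y\<in>K. f x y \<in> U}"
proof (subst open_subopen, safe)
  fix x assume x: "\<forall>y\<in>K. f x y \<in> U"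
  have "open ((\<lambda>p. f (fst p) (snd p)) -` U)"
    using f U by (simp add: open_vimage)
  moreover have "{x} \<times> K \<subseteq> (\<lambda>p. f (fst p) (snd p)) -` U"
    using x by auto
  ultimately obtain X where "x \<in> X" "open X" "X \<times> K \<subseteq> (\<lambda>p. f (fst p) (snd p)) -` U"
    using Elementary_Topology.tube_lemma[OF K, of "(\<lambda>p. f (fst p) (snd p)) -` U" x] by auto
  moreover from this have "X \<subseteq> {x. \<forall>y\<in>K. f x y \<in> U}"
    by fastforce
  ultimately show "\<exists>T. open T \<and> x \<in> T \<and> T \<subseteq> {x. \<forall>y\<in>K. f x y \<in> U}"
    by blast
qed

subsection \<open>Fubini's theorem for a left Haar measure and a finite Radon measure\<close>

text \<open>
  The group need not be second countable, so \<open>(x, y) \<mapsto> - y + x\<close> need not be measurable for the product of the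
  Borel \<open>\<sigma>\<close>-algebras, and \<open>M\<close> need not be \<open>\<sigma>\<close>-finite: the Fubini theorem of the library does not apply.
\<close>

definition finite_radon :: "'g::topological_space measure \<Rightarrow> bool" where
  "finite_radon N \<longleftrightarrow> sets N = sets borel \<and> emeasure N UNIV < \<infinity> \<and>
     (\<forall>A\<in>sets borel. emeasure N A = (SUP K\<in>{K. compact K \<and> K \<subseteq> A}. emeasure N K))"

lemma finite_radon_emeasure_less_top:
  assumes "finite_radon N" shows "emeasure N A < \<infinity>"
proof -
  have "space N = UNIV" using assms unfolding finite_radon_def
    by (metis sets_eq_imp_space_eq space_borel)
  then show ?thesis
    using assms emeasure_space[of N A] unfolding finite_radon_def by (metis le_less_trans)
qed

lemma finite_radon_inner:
  assumes "finite_radon N" "A \<in> sets borel" "t < emeasure N A"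
  obtains K where "compact K" "K \<subseteq> A" "t < emeasure N K"
  using assms unfolding finite_radon_def by (auto simp: less_SUP_iff)

section \<open>Slices of Borel sets, measured by a finite Radon measure\<close>

lemma slice_borel:
  fixes x :: "'g::topological_group_add"
  assumes "E \<in> sets borel"
  shows "{y. - y + x \<in> E} \<in> sets borel"
proof -
  have "(\<lambda>y. - y + x) \<in> borel_measurable borel"
    by (intro borel_measurable_continuous_onI continuous_intros)
  from measurable_sets[OF this assms] show ?thesis by (simp add: vimage_def)
qed

text \<open>Lower semicontinuity of the slice function: inner regularity of \<open>N\<close>
  provides a compact subset of the slice that already has mass above \<open>t\<close>, and that
  compact set remains inside the slices at nearby points.\<close>

lemma open_slice_greater:
  fixes N :: "'g::{topological_group_add,t2_space} measure"
  assumes N: "finite_radon N" and A: "A \<in> sets borel" and U: "open U"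
  shows "open {x. t < emeasure N (A \<inter> {y. - y + x \<in> U})}"
proof (subst open_subopen, safe)
  have sN: "sets N = sets borel" using N unfolding finite_radon_def by auto
  have mAS: "A \<inter> {y. - y + x \<in> U} \<in> sets borel" for x
    using slice_borel[of U x] A U by auto
  fix x assume "t < emeasure N (A \<inter> {y. - y + x \<in> U})"
  then obtain K where K: "compact K" "K \<subseteq> A \<inter> {y. - y + x \<in> U}" "t < emeasure N K"
    using finite_radon_inner[OF N] mAS[of x] by metis
  let ?T = "{x. \<forall>y\<in>K. - y + x \<in> U}"
  have "open ?T"
    by (intro open_forall_compact[OF _ K(1) U] continuous_intros)
  moreover have "x \<in> ?T" using K by auto
  moreover have "t < emeasure N (A \<inter> {y. - y + z \<in> U})" if "z \<in> ?T" for z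
  proof -
    have "emeasure N K \<le> emeasure N (A \<inter> {y. - y + z \<in> U})"
      using that K mAS sN by (intro emeasure_mono) auto
    then show ?thesis using K(3) by simp
  qed
  ultimately show "\<exists>T. open T \<and> x \<in> T \<and> T \<subseteq> {x. t < emeasure N (A \<inter> {y. - y + x \<in> U})}"
    by blast
qed

text \<open>A pi-lambda argument in place of joint measurability: open sets are handled by
  semicontinuity, and complements use that \<open>N\<close> is finite. The factor \<open>A\<close>
  allows slices to be cut into pieces later.\<close>

lemma slice_measurable:
  fixes N :: "'g::{topological_group_add,t2_space} measure"
  assumes N: "finite_radon N" and A: "A \<in> sets borel" and E: "E \<in> sets borel"
  shows "(\<lambda>x. emeasure N (A \<inter> {y. - y + x \<in> E})) \<in> borel_measurable borel"
proof -
  have sN[simp]: "sets N = sets borel" using N unfolding finite_radon_def by auto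
  have Eb: "E \<in> sigma_sets UNIV (Collect open)"
    using E by (metis sets_borel)
  have I: "Int_stable (Collect open :: 'g set set)" by (auto simp: Int_stable_def)
  have b: "X \<in> sets borel" if "X \<in> sigma_sets UNIV (Collect open)" for X :: "'g set"
    using that by (metis sets_borel)
  have mAS: "A \<inter> {y. - y + x \<in> X} \<in> sets N" if "X \<in> sets borel" for X x
    using slice_borel[OF that, of x] A by auto
  have P: "Collect open \<subseteq> Pow (UNIV :: 'g set)" by auto
  from I P Eb show ?thesis
  proof (induction rule: sigma_sets_induct_disjoint)
    case (basic U)
    then have U: "open U" by simp
    show ?case
    proof (rule borel_measurableI_greater)
      fix t :: ennreal
      have "open {x. t < emeasure N (A \<inter> {y. - y + x \<in> U})}"
        by (rule open_slice_greater[OF N A U])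
      then show "{x \<in> space borel. t < emeasure N (A \<inter> {y. - y + x \<in> U})} \<in> sets borel" by simp
    qed
  next
    case (compl X)
    have "emeasure N (A \<inter> {y. - y + x \<in> UNIV - X}) = emeasure N A - emeasure N (A \<inter> {y. - y + x \<in> X})" for x
    proof -
      have "A \<inter> {y. - y + x \<in> UNIV - X} = A - A \<inter> {y. - y + x \<in> X}" by auto
      then show ?thesis
        using mAS[OF b[OF compl(1)], of x] A finite_radon_emeasure_less_top[OF N, of "A \<inter> {y. - y + x \<in> X}"]
        by (simp add: emeasure_Diff)
    qed
    then show ?case using compl by simp
  next
    case (union X)
    have "emeasure N (A \<inter> {y. - y + x \<in> (\<Union>i. X i)}) = (\<Sum>i. emeasure N (A \<inter> {y. - y + x \<in> X i}))" for x
    proof -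
      have "A \<inter> {y. - y + x \<in> (\<Union>i. X i)} = (\<Union>i. A \<inter> {y. - y + x \<in> X i})" by auto
      moreover have "disjoint_family (\<lambda>i. A \<inter> {y. - y + x \<in> X i})"
        using union(1) by (auto simp: disjoint_family_on_def)
      moreover have "range (\<lambda>i. A \<inter> {y. - y + x \<in> X i}) \<subseteq> sets N"
      proof safe
        fix i show "A \<inter> {y. - y + x \<in> X i} \<in> sets N"
          using union(2) by (intro mAS b) blast
      qed
      ultimately show ?thesis by (simp only: suminf_emeasure)
    qed
    then show ?case using union by simp
  qed auto
qed

text \<open>Suprema are taken in one summand at a time, since adding a constant commutes with a
  nonempty supremum; \<open>P {}\<close> ensures nonemptiness. The offset \<open>a\<close> collects
  the summands already replaced by approximants, so that the induction goes through.\<close>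

lemma sum_inner_approx_le:
  fixes F :: "'b set \<Rightarrow> ennreal"
  assumes "finite I" "\<And>k. k \<in> I \<Longrightarrow> F (O' k) = (SUP K\<in>{K. P K \<and> K \<subseteq> O' k}. F K)" "P {}"
    "\<And>C. (\<And>k. k \<in> I \<Longrightarrow> P (C k) \<and> C k \<subseteq> O' k) \<Longrightarrow> a + (\<Sum>k\<in>I. F (C k)) \<le> B"
  shows "a + (\<Sum>k\<in>I. F (O' k)) \<le> B"
  using assms
proof (induction I arbitrary: a rule: finite_induct)
  case (insert j I)
  have "a + F C0 + (\<Sum>k\<in>I. F (O' k)) \<le> B" if C0: "P C0" "C0 \<subseteq> O' j" for C0
  proof (rule insert.IH)
    fix C assume C: "\<And>k. k \<in> I \<Longrightarrow> P (C k) \<and> C k \<subseteq> O' k"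
    have "a + (\<Sum>k\<in>insert j I. F ((C(j := C0)) k)) \<le> B"
      using C C0 insert.hyps by (intro insert.prems(3)) auto
    moreover have "(\<Sum>k\<in>I. F ((C(j := C0)) k)) = (\<Sum>k\<in>I. F (C k))"
      using insert.hyps by (intro sum.cong) auto
    ultimately show "a + F C0 + (\<Sum>k\<in>I. F (C k)) \<le> B"
      using insert.hyps by (simp add: add.assoc)
  qed (use insert.prems in auto)
  then have *: "(a + (\<Sum>k\<in>I. F (O' k))) + F C0 \<le> B" if "P C0" "C0 \<subseteq> O' j" for C0
    using that by (simp add: ac_simps)
  have "a + (\<Sum>k\<in>insert j I. F (O' k)) = (a + (\<Sum>k\<in>I. F (O' k))) + (SUP K\<in>{K. P K \<and> K \<subseteq> O' j}. F K)"
    using insert by (simp add: ac_simps)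
  also have "\<dots> = (SUP K\<in>{K. P K \<and> K \<subseteq> O' j}. (a + (\<Sum>k\<in>I. F (O' k))) + F K)"
    using insert.prems(2) by (intro ennreal_SUP_add_right) auto
  also have "\<dots> \<le> B" using * by (intro SUP_least) auto
  finally show ?case .
qed auto

locale haar_group =
  fixes M :: "'g::{topological_group_add,t2_space} measure"
  assumes loc_compact: "locally_compact_space (euclidean :: 'g topology)"
    and haar: "left_haar_measure M"
begin

lemma sets_M[simp, measurable_cong]: "sets M = sets borel"
  using haar[unfolded left_haar_measure_def, THEN conjunct1] by simp

lemma space_M[simp]: "space M = UNIV"
  using sets_M by (metis sets_eq_imp_space_eq space_borel)

lemma emeasure_compact: "compact K \<Longrightarrow> emeasure M K < \<infinity>"
  using haar[unfolded left_haar_measure_def, THEN conjunct2, THEN conjunct1] by simp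

lemma emeasure_open_pos: "open U \<Longrightarrow> U \<noteq> {} \<Longrightarrow> emeasure M U > 0"
  using haar[unfolded left_haar_measure_def, THEN conjunct2, THEN conjunct2, THEN conjunct1] by simp

lemma emeasure_translate: "A \<in> sets borel \<Longrightarrow> emeasure M ((+) g ` A) = emeasure M A"
  using haar[unfolded left_haar_measure_def, THEN conjunct2, THEN conjunct2, THEN conjunct2, THEN conjunct1] by simp

lemma emeasure_outer:
  "A \<in> sets borel \<Longrightarrow> emeasure M A = (INF U \<in> {U. open U \<and> A \<subseteq> U}. emeasure M U)"
  using haar[unfolded left_haar_measure_def, THEN conjunct2, THEN conjunct2, THEN conjunct2, THEN conjunct2, THEN conjunct1] by simp

lemma emeasure_inner:
  "open U \<Longrightarrow> emeasure M U = (SUP K \<in> {K. compact K \<and> K \<subseteq> U}. emeasure M K)"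
  using haar[unfolded left_haar_measure_def, THEN conjunct2, THEN conjunct2, THEN conjunct2, THEN conjunct2, THEN conjunct2] by simp

text \<open>A locally compact Hausdorff space is regular, hence compact neighbourhoods can be found
  inside any given open one.\<close>

lemma compact_neighbourhood:
  fixes x :: 'g
  assumes "open U" "x \<in> U"
  obtains V K where "open V" "compact K" "x \<in> V" "V \<subseteq> K" "K \<subseteq> U"
proof -
  have "Hausdorff_space (euclidean :: 'g topology)"
    unfolding Hausdorff_space_def disjnt_def
    using hausdorff by auto
  then have "regular_space (euclidean :: 'g topology)"
    using locally_compact_Hausdorff_imp_regular_space[OF loc_compact] by simp
  then have "neighbourhood_base_of (\<lambda>C. compactin euclidean C \<and> closedin euclidean C) (euclidean :: 'g topology)"
    using loc_compact by (simp only: locally_compact_regular_space_neighbourhood_base[symmetric])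
  then have "\<exists>V K. open V \<and> compact K \<and> x \<in> V \<and> V \<subseteq> K \<and> K \<subseteq> U"
    using assms unfolding neighbourhood_base_of open_openin[symmetric] compactin_euclidean_iff by meson
  then show thesis using that by blast
qed

lemma translate_borel: "A \<in> sets borel \<Longrightarrow> (+) (g::'g) ` A \<in> sets borel"
proof -
  assume A: "A \<in> sets borel"
  have "(\<lambda>y. - g + y) \<in> borel_measurable borel"
    by (intro borel_measurable_continuous_onI continuous_intros)
  from measurable_sets[OF this A] have "(\<lambda>y. - g + y) -` A \<in> sets borel" by simp
  also have "(\<lambda>y. - g + y) -` A = (+) g ` A"
    by (auto simp: image_iff algebra_simps) (metis add.assoc add_0_left right_minus)
  finally show ?thesis .
qed

section \<open>Integrals of slice functions against Haar measure\<close>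

text \<open>The germ of Fubini's theorem. For \<open>y\<close> in \<open>j + V\<close> one has
  \<open>y + K \<subseteq> j + U\<close> and \<open>j + K \<subseteq> y + U\<close>; these are the
  two conditions defining \<open>V\<close>. So the slice function of \<open>K\<close> lies below
  \<open>emeasure N A\<close> times the indicator of \<open>j + U\<close>, that of \<open>U\<close>
  lies above the same multiple of the indicator of \<open>j + K\<close>, and left invariance
  evaluates both indicators.\<close>

lemma slice_integral_local:
  fixes K U V :: "'g set"
  assumes N: "finite_radon N" and K: "compact K" and U: "open U"
    and V: "V = {v. \<forall>k\<in>K. v + k \<in> U} \<inter> {v. \<forall>k\<in>K. - v + k \<in> U}"
    and A: "A \<in> sets borel" "A \<subseteq> (+) j ` V"
  shows "(\<integral>\<^sup>+x. emeasure N (A \<inter> {y. - y + x \<in> K}) \<partial>M) \<le> emeasure N A * emeasure M U"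
    and "emeasure N A * emeasure M K \<le> (\<integral>\<^sup>+x. emeasure N (A \<inter> {y. - y + x \<in> U}) \<partial>M)"
proof -
  have sN: "sets N = sets borel" using N unfolding finite_radon_def by auto
  have Kb: "K \<in> sets borel" using K by (simp add: borel_compact)
  have Ub: "U \<in> sets borel" using U by simp
  have "emeasure N (A \<inter> {y. - y + x \<in> K}) \<le> emeasure N A * indicator ((+) j ` U) x" for x
  proof (cases "A \<inter> {y. - y + x \<in> K} = {}")
    case False
    then obtain y v where y: "y \<in> A" "- y + x \<in> K" "y = j + v" "v \<in> V"
      using A by blast
    then have "v + (- y + x) \<in> U" using V by auto
    moreover have "j + (v + (- y + x)) = y + (- y + x)" using y(3)
      by (simp only: add.assoc)
    then have "x = j + (v + (- y + x))" by simp
    ultimately have "x \<in> (+) j ` U" by blast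
    then show ?thesis using A sN by (simp add: emeasure_mono)
  qed auto
  then have "(\<integral>\<^sup>+x. emeasure N (A \<inter> {y. - y + x \<in> K}) \<partial>M)
      \<le> (\<integral>\<^sup>+x. emeasure N A * indicator ((+) j ` U) x \<partial>M)"
    by (intro nn_integral_mono)
  also have "\<dots> = emeasure N A * emeasure M U"
    using translate_borel[OF Ub] by (simp add: nn_integral_cmult_indicator emeasure_translate Ub)
  finally show "(\<integral>\<^sup>+x. emeasure N (A \<inter> {y. - y + x \<in> K}) \<partial>M) \<le> emeasure N A * emeasure M U" .
  have "emeasure N A * indicator ((+) j ` K) x \<le> emeasure N (A \<inter> {y. - y + x \<in> U})" for x
  proof (cases "x \<in> (+) j ` K")
    case True
    then obtain k where k: "k \<in> K" "x = j + k" by auto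
    have "- y + x \<in> U" if "y \<in> A" for y
    proof -
      obtain v where v: "v \<in> V" "y = j + v" using A \<open>y \<in> A\<close> by auto
      then have "- v + k \<in> U" using V k by auto
      moreover have "- y + x = - v + k" 
        by (simp only: v(2) k(2) minus_add add.assoc minus_add_cancel)
      ultimately show ?thesis by simp
    qed
    then have "A \<inter> {y. - y + x \<in> U} = A" by auto
    then show ?thesis using True by simp
  qed auto
  then have "(\<integral>\<^sup>+x. emeasure N A * indicator ((+) j ` K) x \<partial>M)
      \<le> (\<integral>\<^sup>+x. emeasure N (A \<inter> {y. - y + x \<in> U}) \<partial>M)"
    by (intro nn_integral_mono)
  moreover have "(\<integral>\<^sup>+x. emeasure N A * indicator ((+) j ` K) x \<partial>M) = emeasure N A * emeasure M K"
    using translate_borel[OF Kb] by (simp add: nn_integral_cmult_indicator emeasure_translate Kb)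
  ultimately show "emeasure N A * emeasure M K \<le> (\<integral>\<^sup>+x. emeasure N (A \<inter> {y. - y + x \<in> U}) \<partial>M)"
    by simp
qed

lemma slice_integral_split:
  assumes N: "finite_radon N" and A: "A \<in> sets borel" and B: "B \<in> sets borel" and E: "E \<in> sets borel"
  shows "(\<integral>\<^sup>+x. emeasure N (A \<inter> {y. - y + x \<in> E}) \<partial>M) =
    (\<integral>\<^sup>+x. emeasure N (A \<inter> B \<inter> {y. - y + x \<in> E}) \<partial>M) + (\<integral>\<^sup>+x. emeasure N ((A - B) \<inter> {y. - y + x \<in> E}) \<partial>M)"
proof -
  have sN: "sets N = sets borel" using N unfolding finite_radon_def by auto
  have "emeasure N (A \<inter> {y. - y + x \<in> E}) =
      emeasure N (A \<inter> B \<inter> {y. - y + x \<in> E}) + emeasure N ((A - B) \<inter> {y. - y + x \<in> E})" for x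
    using A B slice_borel[OF E, of x] sN by (subst plus_emeasure) (auto intro!: arg_cong2[where f=emeasure])
  then show ?thesis
    using slice_measurable[OF N _ E, of "A \<inter> B"] slice_measurable[OF N _ E, of "A - B"] A B
    by (simp add: nn_integral_add)
qed

text \<open>Finitely many translates of a small neighbourhood of 0 cover \<open>L\<close>, and the
  local estimates add up. The room between \<open>K\<close> and \<open>U\<close> absorbs the
  variation inside one translate.\<close>

lemma slice_integral_compact:
  fixes K U L :: "'g set"
  assumes N: "finite_radon N" and K: "compact K" and U: "open U" and KU: "K \<subseteq> U" and L: "compact L"
  shows "(\<integral>\<^sup>+x. emeasure N (L \<inter> {y. - y + x \<in> K}) \<partial>M) \<le> emeasure N L * emeasure M U"
    and "emeasure N L * emeasure M K \<le> (\<integral>\<^sup>+x. emeasure N (L \<inter> {y. - y + x \<in> U}) \<partial>M)"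
proof -
  have sN: "sets N = sets borel" using N unfolding finite_radon_def by auto
  have Kb: "K \<in> sets borel" using K by (simp add: borel_compact)
  have Ub: "U \<in> sets borel" using U by simp
  define V where V: "V = {v. \<forall>k\<in>K. v + k \<in> U} \<inter> {v. \<forall>k\<in>K. - v + k \<in> U}"
  have oV: "open V" unfolding V
    by (intro open_Int open_forall_compact[OF _ K U] continuous_intros)
  have "0 \<in> V" using KU V by auto
  have oj: "open ((+) j ` V)" for j :: 'g
  proof -
    have "open ((\<lambda>y. - j + y) -` V)"
      by (intro open_vimage oV continuous_intros)
    also have "(\<lambda>y. - j + y) -` V = (+) j ` V"
      by (auto simp: image_iff algebra_simps) (metis add.assoc add_0_left right_minus)
    finally show ?thesis .
  qed
  have "\<forall>c\<in>L. open ((+) c ` V)" "L \<subseteq> (\<Union>c\<in>L. (+) c ` V)"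
    using oj \<open>0 \<in> V\<close> by (auto intro!: rev_image_eqI[of 0])
  then obtain J where J: "finite J" "L \<subseteq> (\<Union>c\<in>J. (+) c ` V)"
    by (metis compactE_image[OF L])
  \<comment> \<open>Generalised over \<open>A\<close>, because the induction peels off one translate
    \<open>?B\<close>: the piece \<open>A \<inter> ?B\<close> is local, and \<open>A - ?B\<close> is
    covered by the remaining translates.\<close>
  have "(\<integral>\<^sup>+x. emeasure N (A \<inter> {y. - y + x \<in> K}) \<partial>M) \<le> emeasure N A * emeasure M U
     \<and> emeasure N A * emeasure M K \<le> (\<integral>\<^sup>+x. emeasure N (A \<inter> {y. - y + x \<in> U}) \<partial>M)"
    if "A \<in> sets borel" "A \<subseteq> (\<Union>c\<in>J. (+) c ` V)" for A
    using J(1) that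
  proof (induction J arbitrary: A rule: finite_induct)
    case (insert j J)
    let ?B = "(+) j ` V"
    have B: "?B \<in> sets borel" using oj by simp
    have 1: "(\<integral>\<^sup>+x. emeasure N ((A - ?B) \<inter> {y. - y + x \<in> K}) \<partial>M) \<le> emeasure N (A - ?B) * emeasure M U"
       "emeasure N (A - ?B) * emeasure M K \<le> (\<integral>\<^sup>+x. emeasure N ((A - ?B) \<inter> {y. - y + x \<in> U}) \<partial>M)"
      using insert.IH[of "A - ?B"] insert.prems B by auto
    have 2: "(\<integral>\<^sup>+x. emeasure N ((A \<inter> ?B) \<inter> {y. - y + x \<in> K}) \<partial>M) \<le> emeasure N (A \<inter> ?B) * emeasure M U"
       "emeasure N (A \<inter> ?B) * emeasure M K \<le> (\<integral>\<^sup>+x. emeasure N ((A \<inter> ?B) \<inter> {y. - y + x \<in> U}) \<partial>M)"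
      using slice_integral_local[OF N K U V, of "A \<inter> ?B" j] insert.prems B by auto
    have 3: "emeasure N A = emeasure N (A \<inter> ?B) + emeasure N (A - ?B)"
      using insert.prems B sN by (subst plus_emeasure) (auto intro!: arg_cong2[where f=emeasure])
    show ?case
      unfolding slice_integral_split[OF N insert.prems(1) B Kb] slice_integral_split[OF N insert.prems(1) B Ub] 3
        distrib_right
      using 1 2 by (intro conjI add_mono)
  qed auto
  from this[of L] J L
  show "(\<integral>\<^sup>+x. emeasure N (L \<inter> {y. - y + x \<in> K}) \<partial>M) \<le> emeasure N L * emeasure M U"
    and "emeasure N L * emeasure M K \<le> (\<integral>\<^sup>+x. emeasure N (L \<inter> {y. - y + x \<in> U}) \<partial>M)"
    by (auto simp: borel_compact)
qed

text \<open>The integral for \<open>U\<close> dominates every product from compact \<open>L\<close>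
  and \<open>K \<subseteq> U\<close>, so both compact sets can be removed by suprema, using inner
  regularity of \<open>N\<close> and of \<open>M\<close>.\<close>

lemma slice_integral_open_ge:
  assumes N: "finite_radon N" and U: "open U"
  shows "emeasure N UNIV * emeasure M U \<le> (\<integral>\<^sup>+x. emeasure N {y. - y + x \<in> U} \<partial>M)"
proof -
  have sN: "sets N = sets borel" using N unfolding finite_radon_def by auto
  have "emeasure N L * emeasure M K \<le> (\<integral>\<^sup>+x. emeasure N {y. - y + x \<in> U} \<partial>M)"
    if "compact K" "K \<subseteq> U" "compact L" for K L
  proof -
    have "emeasure N L * emeasure M K \<le> (\<integral>\<^sup>+x. emeasure N (L \<inter> {y. - y + x \<in> U}) \<partial>M)"
      using slice_integral_compact(2)[OF N that(1) U that(2,3)] .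
    also have "\<dots> \<le> (\<integral>\<^sup>+x. emeasure N {y. - y + x \<in> U} \<partial>M)"
      using slice_borel[of U] U sN by (intro nn_integral_mono emeasure_mono) auto
    finally show ?thesis .
  qed
  then have "emeasure N L * emeasure M U \<le> (\<integral>\<^sup>+x. emeasure N {y. - y + x \<in> U} \<partial>M)"
    if "compact L" for L
    using that unfolding emeasure_inner[OF U] SUP_mult_left_ennreal by (intro SUP_least) auto
  moreover have NU: "emeasure N UNIV = (SUP K\<in>{K. compact K}. emeasure N K)"
    using N unfolding finite_radon_def by force
  ultimately show ?thesis
    unfolding NU SUP_mult_right_ennreal by (intro SUP_least) auto
qed

text \<open>Compactness of \<open>C\<close> makes the local witnesses of semicontinuity uniform: one
  compact pair \<open>L\<close>, \<open>K\<close> works for all of \<open>C\<close>. This replaces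
  the open \<open>U\<close> by a compact \<open>K\<close>, to which the upper bound of
  \<open>slice_integral_compact\<close> applies.\<close>

lemma slice_greater_compact:
  fixes U :: "'g set"
  assumes N: "finite_radon N" and U: "open U" and C: "compact C"
    and t: "\<And>x. x \<in> C \<Longrightarrow> t < emeasure N {y. - y + x \<in> U}"
  shows "\<exists>L K. compact L \<and> compact K \<and> K \<subseteq> U \<and> (\<forall>x\<in>C. t < emeasure N (L \<inter> {y. - y + x \<in> K}))"
proof -
  have sN: "sets N = sets borel" using N unfolding finite_radon_def by auto
  have "\<exists>V L K. open V \<and> x \<in> V \<and> compact L \<and> compact K \<and> K \<subseteq> U \<and> t < emeasure N L \<and>
      (\<forall>z\<in>V. \<forall>y\<in>L. - y + z \<in> K)" if x: "x \<in> C" for x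
  proof -
    obtain L where L: "compact L" "L \<subseteq> {y. - y + x \<in> U}" "t < emeasure N L"
      using finite_radon_inner[OF N slice_borel[of U x] t[OF x]] U by auto
    have "open {z. \<forall>y\<in>L. - y + z \<in> U}"
      by (intro open_forall_compact[OF _ L(1) U] continuous_intros)
    moreover have "x \<in> {z. \<forall>y\<in>L. - y + z \<in> U}" using L by auto
    ultimately obtain V D where V: "open V" "compact D" "x \<in> V" "V \<subseteq> D" "D \<subseteq> {z. \<forall>y\<in>L. - y + z \<in> U}"
      by (rule compact_neighbourhood)
    \<comment> \<open>The compact neighbourhood \<open>D\<close> of \<open>x\<close> is needed here:
      all differences of points of \<open>L\<close> and \<open>D\<close> form a compact subset of
      \<open>U\<close>.\<close>
    let ?K = "(\<lambda>p. - fst p + snd p) ` (L \<times> D)"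
    have "compact ?K"
      by (intro compact_continuous_image continuous_intros compact_Times L V)
    moreover have "?K \<subseteq> U" using V(5) by auto
    moreover have "\<forall>z\<in>V. \<forall>y\<in>L. - y + z \<in> ?K"
      using V(4) by (auto intro!: image_eqI[where x="(_, _)"])
    ultimately show ?thesis using V(1,3) L(1,3) by (intro exI[of _ V] exI[of _ L] exI[of _ ?K] conjI)
  qed
  then obtain V L K where VLK: "\<And>x. x \<in> C \<Longrightarrow> open (V x) \<and> x \<in> V x \<and> compact (L x) \<and> compact (K x)
      \<and> K x \<subseteq> U \<and> t < emeasure N (L x) \<and> (\<forall>z\<in>V x. \<forall>y\<in>L x. - y + z \<in> K x)"
    by metis
  then have "\<forall>c\<in>C. open (V c)" "C \<subseteq> (\<Union>c\<in>C. V c)" by auto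
  then obtain J where J: "J \<subseteq> C" "finite J" "C \<subseteq> (\<Union>c\<in>J. V c)"
    by (metis compactE_image[OF C])
  let ?L = "\<Union>c\<in>J. L c" let ?K = "\<Union>c\<in>J. K c"
  have cL: "compact ?L" and cK: "compact ?K"
    using J VLK by (auto intro!: compact_UN)
  moreover have "?K \<subseteq> U" using J VLK by blast
  moreover have "t < emeasure N (?L \<inter> {y. - y + x \<in> ?K})" if xC: "x \<in> C" for x
  proof -
    obtain c where c: "c \<in> J" "x \<in> V c" using xC J by blast
    then have "t < emeasure N (L c)" using VLK J by auto
    also have "\<dots> \<le> emeasure N (?L \<inter> {y. - y + x \<in> ?K})"
    proof (rule emeasure_mono)
      show "L c \<subseteq> ?L \<inter> {y. - y + x \<in> ?K}" using c VLK J by blast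
      show "?L \<inter> {y. - y + x \<in> ?K} \<in> sets N"
        unfolding sN using slice_borel[of ?K x] cL cK by (intro sets.Int) (auto simp: borel_compact)
    qed
    finally show ?thesis .
  qed
  ultimately show ?thesis by blast
qed

text \<open>
  The slice function of an open set is lower semicontinuous. Its super-level sets are open, hence inner regular,
  and on compact subsets of finitely many of them it is approximated from below by the slice function of a compact set.
\<close>

lemma slice_integral_open_le:
  assumes N: "finite_radon N" and U: "open U"
  shows "(\<integral>\<^sup>+x. emeasure N {y. - y + x \<in> U} \<partial>M) \<le> emeasure N UNIV * emeasure M U"
proof -
  have sN: "sets N = sets borel" using N unfolding finite_radon_def by auto
  define H where "H x = measure N {y. - y + x \<in> U}" for x
  have eq: "emeasure N A = ennreal (measure N A)" for A
    using finite_radon_emeasure_less_top[OF N, of A] by (simp add: emeasure_eq_ennreal_measure less_top)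
  have Hm: "(\<lambda>x. ennreal (H x)) \<in> borel_measurable M"
    using slice_measurable[OF N, of UNIV U] U by (simp add: H_def eq)
  have Hn: "H x \<ge> 0" for x by (simp add: H_def)
  have Hle: "H x \<le> measure N UNIV" for x
  proof -
    have "emeasure N {y. - y + x \<in> U} \<le> emeasure N UNIV"
      using sN by (intro emeasure_mono) auto
    then show ?thesis by (simp add: H_def eq)
  qed
  \<comment> \<open>Layer-cake estimate with mesh \<open>c = 1 / (n + 1)\<close>: the slice function
    \<open>H\<close>, lowered by \<open>c\<close>, lies below a step function on its super-level
    sets \<open>W k\<close>. The bound \<open>m\<close> is chosen so that no level above
    \<open>m * c\<close> is reached.\<close>
  have step: "(\<integral>\<^sup>+x. ennreal (H x - inverse (real (Suc n))) \<partial>M) \<le> emeasure N UNIV * emeasure M U" for n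
  proof -
    define c where "c = inverse (real (Suc n))"
    have c: "c > 0" by (simp add: c_def)
    obtain m :: nat where m: "measure N UNIV / c \<le> real m" using real_arch_simple by blast
    define W where "W k = {x. ennreal (real k * c) < emeasure N {y. - y + x \<in> U}}" for k :: nat
    have oW: "open (W k)" for k
      unfolding W_def using open_slice_greater[OF N _ U, of UNIV] by simp
    have WM: "W k \<in> sets M" for k using oW by simp
    have W_iff: "x \<in> W k \<longleftrightarrow> real k * c < H x" for x k
      using c by (simp add: W_def eq H_def ennreal_less_iff)
    have low: "ennreal (H x - c) \<le> (\<Sum>k=1..m. ennreal c * indicator (W k) x)" for x
    proof (cases "H x \<le> c")
      case False
      \<comment> \<open>\<open>j\<close> is the largest integer strictly below
        \<open>H x / c\<close>, so it counts the levels \<open>k \<ge> 1\<close> with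
        \<open>x \<in> W k\<close>. The strict inequality in \<open>W k\<close> calls for the
        ceiling minus 1 instead of the floor.\<close>
      define j where "j = nat (\<lceil>H x / c\<rceil> - 1)"
      have "1 < H x / c" using False c by (simp add: field_simps)
      then have j1: "real j = of_int \<lceil>H x / c\<rceil> - 1"
        unfolding j_def by linarith
      then have j: "real j < H x / c" "H x / c - 1 \<le> real j" by linarith+
      have "H x / c \<le> measure N UNIV / c" using Hle c by (intro divide_right_mono) auto
      then have "j \<le> m" using m j by linarith
      have jc: "real j * c < H x" using j(1) c by (simp add: field_simps)
      have "H x - c \<le> real j * c" using j(2) c by (simp add: field_simps)
      then have "ennreal (H x - c) \<le> ennreal (real j * c)" by (rule ennreal_leI)
      also have "\<dots> = (\<Sum>k=1..j. ennreal c)"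
        using c by (simp add: ennreal_mult ennreal_of_nat_eq_real_of_nat)
      also have "\<dots> = (\<Sum>k=1..j. ennreal c * indicator (W k) x)"
      proof (intro sum.cong refl)
        fix k assume k: "k \<in> {1..j}"
        then have "real k * c \<le> real j * c" using c by (intro mult_right_mono) auto
        then have "x \<in> W k" using jc by (simp add: W_iff)
        then show "ennreal c = ennreal c * indicator (W k) x" by simp
      qed
      also have "\<dots> \<le> (\<Sum>k=1..m. ennreal c * indicator (W k) x)"
        using \<open>j \<le> m\<close> by (intro sum_mono2) auto
      finally show ?thesis .
    qed (simp add: ennreal_neg)
    \<comment> \<open>All levels must be approximated by compact sets simultaneously, since a single
      pair \<open>?L\<close>, \<open>?K\<close> has to serve the whole sum. The \<open>0 +\<close>
      is the initial offset of \<open>sum_inner_approx_le\<close>.\<close>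
    have "0 + (\<Sum>k=1..m. ennreal c * emeasure M (W k)) \<le> emeasure N UNIV * emeasure M U"
    proof (rule sum_inner_approx_le[where P = compact])
      fix k show "ennreal c * emeasure M (W k) = (SUP K\<in>{K. compact K \<and> K \<subseteq> W k}. ennreal c * emeasure M K)"
        unfolding SUP_mult_left_ennreal[symmetric] using emeasure_inner[OF oW] by simp
    next
      fix C :: "nat \<Rightarrow> 'g set" assume "\<And>k. k \<in> {1..m} \<Longrightarrow> compact (C k) \<and> C k \<subseteq> W k"
      then have C: "\<And>k. k \<in> {1..m} \<Longrightarrow> compact (C k)" "\<And>k. k \<in> {1..m} \<Longrightarrow> C k \<subseteq> W k" by auto
      have "\<forall>k\<in>{1..m}. \<exists>L K. compact L \<and> compact K \<and> K \<subseteq> U \<and> (\<forall>x\<in>C k. ennreal (real k * c) < emeasure N (L \<inter> {y. - y + x \<in> K}))"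
        using C by (intro ballI slice_greater_compact[OF N U]) (auto simp: W_def)
      then obtain L K where LK: "\<And>k. k \<in> {1..m} \<Longrightarrow> compact (L k) \<and> compact (K k) \<and> K k \<subseteq> U \<and>
          (\<forall>x\<in>C k. ennreal (real k * c) < emeasure N (L k \<inter> {y. - y + x \<in> K k}))"
        by metis
      let ?L = "\<Union>k\<in>{1..m}. L k" let ?K = "\<Union>k\<in>{1..m}. K k"
      have cL: "compact ?L" and cK: "compact ?K" and KU: "?K \<subseteq> U"
        using LK by (auto intro!: compact_UN) blast
      have Sb: "?L \<inter> {y. - y + x \<in> ?K} \<in> sets N" for x
        unfolding sN using slice_borel[of ?K x] cL cK by (intro sets.Int) (auto simp: borel_compact)
      \<comment> \<open>Every level \<open>k\<close> with \<open>x \<in> C k\<close> satisfies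
        \<open>k * c < R\<close>, so there are at most \<open>R / c\<close> such levels. The step
        function on the compact sets therefore stays below the slice function of the compact
        pair.\<close>
      have up: "(\<Sum>k=1..m. ennreal c * indicator (C k) x) \<le> emeasure N (?L \<inter> {y. - y + x \<in> ?K})" for x
      proof -
        define R where "R = measure N (?L \<inter> {y. - y + x \<in> ?K})"
        define T where "T = {k\<in>{1..m}. x \<in> C k}"
        have R0: "R \<ge> 0" by (simp add: R_def)
        have "real k * c < R" if "k \<in> T" for k
        proof -
          have k: "k \<in> {1..m}" "x \<in> C k" using that by (auto simp: T_def)
          have "ennreal (real k * c) < emeasure N (L k \<inter> {y. - y + x \<in> K k})" using LK k by blast
          also have "\<dots> \<le> emeasure N (?L \<inter> {y. - y + x \<in> ?K})"
            using k by (intro emeasure_mono Sb) auto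
          finally show ?thesis using c by (simp add: eq R_def ennreal_less_iff)
        qed
        then have "T \<subseteq> {1..nat \<lfloor>R / c\<rfloor>}"
          using c by (force simp: T_def le_nat_floor field_simps)
        then have "card T \<le> nat \<lfloor>R / c\<rfloor>" using card_mono[of "{1..nat \<lfloor>R / c\<rfloor>}" T] by simp
        then have "real (card T) \<le> R / c" using R0 c by (simp add: le_nat_iff le_floor_iff)
        then have le: "real (card T) * c \<le> R" using c by (simp add: field_simps)
        have "(\<Sum>k=1..m. ennreal c * indicator (C k) x) = (\<Sum>k\<in>T. ennreal c)"
          unfolding T_def sum.inter_filter[OF finite_atLeastAtMost] by (intro sum.cong) auto
        also have "\<dots> = ennreal (real (card T) * c)"
          using c by (simp add: ennreal_mult ennreal_of_nat_eq_real_of_nat)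
        also have "\<dots> \<le> emeasure N (?L \<inter> {y. - y + x \<in> ?K})"
          using le by (simp add: eq R_def ennreal_leI)
        finally show ?thesis .
      qed
      have CM: "C k \<in> sets M" if "k \<in> {1..m}" for k using C(1)[OF that] by (simp add: borel_compact)
      have "(\<Sum>k=1..m. ennreal c * emeasure M (C k)) = (\<integral>\<^sup>+x. (\<Sum>k=1..m. ennreal c * indicator (C k) x) \<partial>M)"
        using CM by (subst nn_integral_sum) (auto simp: nn_integral_cmult_indicator)
      also have "\<dots> \<le> (\<integral>\<^sup>+x. emeasure N (?L \<inter> {y. - y + x \<in> ?K}) \<partial>M)"
        by (intro nn_integral_mono up)
      also have "\<dots> \<le> emeasure N ?L * emeasure M U"
        by (rule slice_integral_compact(1)[OF N cK U KU cL])
      also have "\<dots> \<le> emeasure N UNIV * emeasure M U"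
        using sN by (intro mult_right_mono emeasure_mono) auto
      finally show "0 + (\<Sum>k=1..m. ennreal c * emeasure M (C k)) \<le> emeasure N UNIV * emeasure M U"
        by simp
    qed auto
    moreover have "(\<integral>\<^sup>+x. ennreal (H x - c) \<partial>M) \<le> (\<integral>\<^sup>+x. (\<Sum>k=1..m. ennreal c * indicator (W k) x) \<partial>M)"
      by (intro nn_integral_mono low)
    moreover have "(\<integral>\<^sup>+x. (\<Sum>k=1..m. ennreal c * indicator (W k) x) \<partial>M) = (\<Sum>k=1..m. ennreal c * emeasure M (W k))"
      using WM by (subst nn_integral_sum) (auto simp: nn_integral_cmult_indicator)
    ultimately show ?thesis by (simp add: c_def)
  qed
  \<comment> \<open>As the mesh tends to 0, monotone convergence recovers \<open>H\<close> from its
    lowered versions.\<close>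
  have "(\<lambda>n. \<integral>\<^sup>+x. ennreal (H x - inverse (real (Suc n))) \<partial>M) \<longlonglongrightarrow> (\<integral>\<^sup>+x. ennreal (H x) \<partial>M)"
  proof (rule nn_integral_LIMSEQ)
    show "incseq (\<lambda>n x. ennreal (H x - inverse (real (Suc n))))"
      by (auto simp: incseq_def le_fun_def intro!: ennreal_leI le_imp_inverse_le)
    show "(\<lambda>x. ennreal (H x - inverse (real (Suc n)))) \<in> borel_measurable M" for n
    proof -
      have "(\<lambda>x. H x) \<in> borel_measurable M"
        using measurable_compose[OF Hm, of enn2real borel] Hn by simp
      then show ?thesis by measurable
    qed
    show "(\<lambda>n. ennreal (H x - inverse (real (Suc n)))) \<longlonglongrightarrow> ennreal (H x)" for x
      using tendsto_diff[OF tendsto_const LIMSEQ_inverse_real_of_nat, of "H x"] by (intro tendsto_ennrealI) simp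
  qed
  from LIMSEQ_le_const2[OF this] step have "(\<integral>\<^sup>+x. ennreal (H x) \<partial>M) \<le> emeasure N UNIV * emeasure M U"
    by blast
  then show ?thesis by (simp add: H_def eq)
qed

lemma slice_integral_open:
  assumes "finite_radon N" "open U"
  shows "(\<integral>\<^sup>+x. emeasure N {y. - y + x \<in> U} \<partial>M) = emeasure N UNIV * emeasure M U"
  by (intro antisym slice_integral_open_le slice_integral_open_ge assms)

text \<open>Outer regularity of \<open>M\<close> transfers the upper bound from open supersets to
  \<open>E\<close>.\<close>

lemma slice_integral_borel_le:
  assumes N: "finite_radon N" and E: "E \<in> sets borel"
  shows "(\<integral>\<^sup>+x. emeasure N {y. - y + x \<in> E} \<partial>M) \<le> emeasure N UNIV * emeasure M E"
proof -
  have sN: "sets N = sets borel" using N unfolding finite_radon_def by auto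
  show ?thesis
  proof (cases "emeasure N UNIV = 0")
    case True
    then have "emeasure N A = 0" if "A \<in> sets borel" for A
      using that sN by (metis emeasure_mono le_zero_eq sets.top subset_UNIV space_borel)
    then show ?thesis using slice_borel[OF E] by simp
  next
    case False
    let ?S = "\<integral>\<^sup>+x. emeasure N {y. - y + x \<in> E} \<partial>M"
    have fin: "emeasure N UNIV < top" using finite_radon_emeasure_less_top[OF N] by simp
    \<comment> \<open>Division by the total mass isolates \<open>emeasure M U\<close>, so the
      infimum over \<open>U\<close> can be taken directly; this is why total mass 0 is a separate
      case.\<close>
    have "?S / emeasure N UNIV \<le> emeasure M U" if "open U" "E \<subseteq> U" for U
    proof -
      have "?S \<le> (\<integral>\<^sup>+x. emeasure N {y. - y + x \<in> U} \<partial>M)"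
        using that sN slice_borel[of U] by (intro nn_integral_mono emeasure_mono) auto
      also have "\<dots> \<le> emeasure N UNIV * emeasure M U" by (rule slice_integral_open_le[OF N that(1)])
      finally show ?thesis using False fin
        by (intro divide_le_posI_ennreal) (auto simp: mult.commute zero_less_iff_neq_zero)
    qed
    then have "?S / emeasure N UNIV \<le> emeasure M E"
      unfolding emeasure_outer[OF E] by (intro INF_greatest) auto
    then have "?S / emeasure N UNIV * emeasure N UNIV \<le> emeasure M E * emeasure N UNIV"
      by (rule mult_right_mono) simp
    also have "?S / emeasure N UNIV * emeasure N UNIV = ?S"
      using False fin by (simp add: ennreal_divide_times ennreal_mult_divide_eq less_top)
    finally show ?thesis by (simp add: mult.commute)
  qed
qed

text \<open>Equality by complementation in an open \<open>U\<close> of finite measure: it holds for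
  \<open>U\<close>, and the upper bounds for \<open>E\<close> and \<open>U - E\<close> add up to
  exactly that value, so neither can be strict. Finiteness permits the cancellation.\<close>

lemma slice_integral_borel:
  assumes N: "finite_radon N" and E: "E \<in> sets borel" and fin: "emeasure M E < \<infinity>"
  shows "(\<integral>\<^sup>+x. emeasure N {y. - y + x \<in> E} \<partial>M) = emeasure N UNIV * emeasure M E"
proof (rule antisym[OF slice_integral_borel_le[OF N E]])
  have sN: "sets N = sets borel" using N unfolding finite_radon_def by auto
  let ?S = "\<lambda>E. \<integral>\<^sup>+x. emeasure N {y. - y + x \<in> E} \<partial>M"
  obtain U where U: "open U" "E \<subseteq> U" "emeasure M U < \<infinity>"
    using fin unfolding emeasure_outer[OF E] INF_less_iff by auto
  have UE: "U - E \<in> sets borel" using U E by auto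
  have nfin: "emeasure N UNIV < top" using finite_radon_emeasure_less_top[OF N] by simp
  have "emeasure N {y. - y + x \<in> U} = emeasure N {y. - y + x \<in> E} + emeasure N {y. - y + x \<in> U - E}" for x
    using U slice_borel[OF E, of x] slice_borel[OF UE, of x] sN
    by (subst plus_emeasure) (auto intro!: arg_cong2[where f=emeasure])
  then have "?S U = ?S E + ?S (U - E)"
    using slice_measurable[OF N _ E, of UNIV] slice_measurable[OF N _ UE, of UNIV] by (simp add: nn_integral_add)
  then have 1: "?S E + ?S (U - E) = emeasure N UNIV * emeasure M E + emeasure N UNIV * emeasure M (U - E)"
    using slice_integral_open[OF N U(1)] plus_emeasure[of E M "U - E"] E UE U(2)
    by (simp add: distrib_left[symmetric] Un_absorb1 Un_Diff_cancel)
  have 2: "?S (U - E) \<le> emeasure N UNIV * emeasure M (U - E)"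
    by (rule slice_integral_borel_le[OF N UE])
  have "emeasure M (U - E) \<le> emeasure M U" using U by (intro emeasure_mono) auto
  then have 3: "emeasure N UNIV * emeasure M (U - E) < top"
    using nfin U(3) by (auto simp: ennreal_mult_less_top)
  have "emeasure N UNIV * emeasure M (U - E) + emeasure N UNIV * emeasure M E \<le> emeasure N UNIV * emeasure M (U - E) + ?S E"
    using add_left_mono[OF 2, of "?S E"] unfolding 1 by (simp add: add.commute)
  then show "emeasure N UNIV * emeasure M E \<le> ?S E"
    using 3 by (auto simp: ennreal_add_left_cancel_le)
qed

section \<open>Inner regularity of integrable densities\<close>

text \<open>Haar measure is inner regular on open sets by definition; here this is extended to sets
  of finite measure. Take an open \<open>U\<close> around \<open>A\<close>, a compact
  \<open>K\<close> nearly filling \<open>U\<close>, and a small open \<open>V\<close> containing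
  \<open>U - A\<close>; then \<open>K - V\<close> is compact, lies in \<open>A\<close>, and misses
  little of it.\<close>

lemma inner_regular_finite:
  assumes A: "A \<in> sets borel" and fin: "emeasure M A < \<infinity>" and e: "0 < (e::real)"
  shows "\<exists>K. compact K \<and> K \<subseteq> A \<and> emeasure M (A - K) < ennreal e"
proof -
  have e2: "0 < ennreal (e/2)" using e by simp
  have "(INF U \<in> {U. open U \<and> A \<subseteq> U}. emeasure M U) < emeasure M A + ennreal (e/2)"
    using emeasure_outer[OF A] fin e2 by (metis add.right_neutral ennreal_add_left_cancel_less less_irrefl)
  then obtain U where U: "open U" "A \<subseteq> U" "emeasure M U < emeasure M A + ennreal (e/2)"
    unfolding INF_less_iff by auto
  have Ufin: "emeasure M U < top" using U(3) fin by (metis ennreal_add_less_top ennreal_less_top infinity_ennreal_def less_trans)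
  have UA: "emeasure M (U - A) < ennreal (e/2)"
  proof -
    have "emeasure M (U - A) = emeasure M U - emeasure M A"
      using U A fin by (intro emeasure_Diff) auto
    moreover have "emeasure M A \<le> emeasure M U" using U by (intro emeasure_mono) auto
    ultimately show ?thesis using U(3) fin by (simp add: minus_less_iff_ennreal add.commute)
  qed
  obtain K where K: "compact K" "K \<subseteq> U" "emeasure M (U - K) < ennreal (e/2)"
  proof (cases "emeasure M U = 0")
    case True
    then show thesis using that[of "{}"] e2 by simp
  next
    case False
    have "emeasure M U - ennreal (e/2) < emeasure M U"
      using False Ufin e2 by (intro ennreal_between) (auto simp: zero_less_iff_neq_zero)
    then obtain K where K: "compact K" "K \<subseteq> U" "emeasure M U - ennreal (e/2) < emeasure M K"
      using emeasure_inner[OF U(1)] unfolding less_SUP_iff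
      by (metis (mono_tags, lifting) less_SUP_iff mem_Collect_eq)
    have "emeasure M (U - K) = emeasure M U - emeasure M K"
      using U K emeasure_compact[OF K(1)] by (intro emeasure_Diff) (auto simp: borel_compact)
    moreover have "emeasure M U < emeasure M K + ennreal (e/2)"
      using K(3) by (metis ennreal_le_minus_iff not_le)
    ultimately have "emeasure M (U - K) < ennreal (e/2)"
      using emeasure_compact[OF K(1)] K U by (simp add: minus_less_iff_ennreal emeasure_mono add.commute)
    then show thesis using that K by blast
  qed
  have "U - A \<in> sets borel" using U A by auto
  from UA[unfolded emeasure_outer[OF this] INF_less_iff]
  obtain V where V: "open V" "U - A \<subseteq> V" "emeasure M V < ennreal (e/2)" by auto
  have Kb: "K \<in> sets borel" using K by (simp add: borel_compact)
  have "emeasure M (A - (K - V)) \<le> emeasure M ((U - K) \<union> V)"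
    using U(1,2) Kb V(1,2) by (intro emeasure_mono) auto
  also have "\<dots> \<le> emeasure M (U - K) + emeasure M V"
    using U(1) Kb V(1) by (intro emeasure_subadditive) auto
  also have "\<dots> < ennreal (e/2 + e/2)" by (intro add_mono_ennreal K V)
  finally have "emeasure M (A - (K - V)) < ennreal e" by simp
  moreover have "compact (K - V)" using K V by (intro compact_diff)
  moreover have "K - V \<subseteq> A" using K V U by auto
  ultimately show ?thesis by blast
qed

text \<open>An integrable density lives on a \<sigma>-finite part of the group: by Markov's
  inequality the sets \<open>B n\<close>, where \<open>h\<close> is at least
  \<open>1 / (n + 1)\<close>, have finite Haar measure and are inner regular, and they exhaust the
  part of \<open>A\<close> where \<open>h\<close> is positive.\<close>

lemma finite_radon_density:
  assumes h[measurable]: "h \<in> borel_measurable borel" and fin: "(\<integral>\<^sup>+x. h x \<partial>M) < \<infinity>"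
  shows "finite_radon (density M h)"
proof -
  let ?N = "density M h"
  have em: "emeasure ?N A = (\<integral>\<^sup>+x. h x * indicator A x \<partial>M)" if "A \<in> sets borel" for A
    using that h by (subst emeasure_density) auto
  have "emeasure ?N A = (SUP K\<in>{K. compact K \<and> K \<subseteq> A}. emeasure ?N K)" (is "_ = ?S") if A: "A \<in> sets borel" for A
  proof (rule antisym)
    show "?S \<le> emeasure ?N A" using A by (intro SUP_least emeasure_mono) auto
    define B where "B n = {x\<in>A. 1 \<le> of_nat (Suc n) * h x}" for n
    have Bb: "B n \<in> sets borel" for n
    proof -
      have "{x\<in>space borel. 1 \<le> of_nat (Suc n) * h x} \<in> sets borel" by measurable
      with A have "A \<inter> {x\<in>space borel. 1 \<le> of_nat (Suc n) * h x} \<in> sets borel" by blast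
      also have "A \<inter> {x\<in>space borel. 1 \<le> of_nat (Suc n) * h x} = B n" unfolding B_def by auto
      finally show ?thesis .
    qed
    have BS: "emeasure ?N (B n) \<le> ?S" for n
    proof -
      have "emeasure M (B n) \<le> of_nat (Suc n) * (\<integral>\<^sup>+x. h x * indicator A x \<partial>M)"
        unfolding B_def using A by (intro nn_integral_Markov_inequality) auto
      also have "\<dots> \<le> of_nat (Suc n) * (\<integral>\<^sup>+x. h x \<partial>M)"
        by (intro mult_left_mono nn_integral_mono) (auto simp: indicator_def)
      also have "\<dots> < \<infinity>" using fin of_nat_less_top[of "Suc n"] by (simp add: ennreal_mult_less_top del: of_nat_Suc)
      finally have Bfin: "emeasure M (B n) < \<infinity>" .
      have "\<forall>j. \<exists>K. compact K \<and> K \<subseteq> B n \<and> emeasure M (B n - K) < ennreal (inverse (real (Suc j)))"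
        by (intro allI inner_regular_finite Bb Bfin) simp
      then obtain K where K: "\<And>j. compact (K j)" "\<And>j. K j \<subseteq> B n"
        "\<And>j. emeasure M (B n - K j) < ennreal (inverse (real (Suc j)))" by metis
      have Kb: "K j \<in> sets borel" for j using K by (simp add: borel_compact)
      \<comment> \<open>The compact sets fill \<open>B n\<close> up to a Haar null set, which is
        also null for the density. Continuity from below along finite unions of the
        \<open>K j\<close> then stays within compact sets.\<close>
      define D where "D = (\<Union>j. K j)"
      have Db: "D \<in> sets borel" using Kb by (auto simp: D_def)
      have BDb: "B n - D \<in> sets borel" using Db Bb by auto
      have "emeasure M (B n - D) \<le> ennreal (inverse (real (Suc j)))" for j
      proof -
        have "emeasure M (B n - D) \<le> emeasure M (B n - K j)"
          using Bb Kb by (intro emeasure_mono) (auto simp: D_def)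
        also have "\<dots> \<le> ennreal (inverse (real (Suc j)))" using K(3)[of j] by simp
        finally show ?thesis .
      qed
      moreover have "(\<lambda>j. ennreal (inverse (real (Suc j)))) \<longlonglongrightarrow> ennreal 0"
        by (intro tendsto_ennrealI LIMSEQ_inverse_real_of_nat)
      ultimately have "emeasure M (B n - D) \<le> 0"
        by (intro LIMSEQ_le_const[of "\<lambda>j. ennreal (inverse (real (Suc j)))"]) auto
      then have "B n - D \<in> null_sets M" using BDb by (auto intro: null_setsI)
      then have "emeasure ?N (B n - D) = 0" by (simp add: em[OF BDb] nn_integral_null_set)
      moreover have "emeasure ?N (B n) \<le> emeasure ?N (D \<union> (B n - D))"
        using Bb Db by (intro emeasure_mono) auto
      moreover have "emeasure ?N (D \<union> (B n - D)) \<le> emeasure ?N D + emeasure ?N (B n - D)"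
        using BDb Db by (intro emeasure_subadditive) auto
      ultimately have "emeasure ?N (B n) \<le> emeasure ?N D" by simp
      also have "D = (\<Union>J. \<Union>j\<in>{..J}. K j)" by (auto simp: D_def)
      also have "emeasure ?N \<dots> = (SUP J. emeasure ?N (\<Union>j\<in>{..J}. K j))"
        using Kb by (intro SUP_emeasure_incseq[symmetric]) (auto simp: incseq_def intro: order_trans)
      also have "\<dots> \<le> ?S"
      proof (intro SUP_least SUP_upper)
        fix J
        have "compact (\<Union>j\<in>{..J}. K j)" using K(1) by (intro compact_UN) auto
        moreover have "(\<Union>j\<in>{..J}. K j) \<subseteq> A" using K(2) unfolding B_def by blast
        ultimately show "(\<Union>j\<in>{..J}. K j) \<in> {K. compact K \<and> K \<subseteq> A}" by simp
      qed
      finally show ?thesis .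
    qed
    have UB: "(\<Union>n. B n) = {x\<in>A. 0 < h x}"
    proof safe
      fix x n assume "x \<in> B n" then show "x \<in> A" "0 < h x"
        unfolding B_def by (auto simp: zero_less_iff_neq_zero)
    next
      fix x assume x: "x \<in> A" "0 < h x"
      obtain n where "1 \<le> of_nat (Suc n) * h x"
      proof (cases "h x")
        case (real r)
        then have "0 < r" using x by simp
        then obtain n where "inverse (real (Suc n)) < r" using reals_Archimedean by blast
        then have "1 \<le> real (Suc n) * r" by (simp add: field_simps)
        then have "ennreal 1 \<le> ennreal (real (Suc n) * r)" by (rule ennreal_leI)
        also have "\<dots> = of_nat (Suc n) * h x" using real \<open>0 < r\<close>
          by (simp only: ennreal_mult ennreal_of_nat_eq_real_of_nat of_nat_0_le_iff less_imp_le)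
        finally show thesis using that by simp
      next
        case top then show thesis using that[of 0] by simp
      qed
      then show "x \<in> (\<Union>n. B n)" using x by (auto simp: B_def)
    qed
    have "incseq B"
    proof (rule incseq_SucI, rule subsetI)
      fix n x assume x: "x \<in> B n"
      have "of_nat (Suc n) * h x \<le> of_nat (Suc (Suc n)) * h x"
        by (intro mult_right_mono) (auto simp: add_increasing)
      then show "x \<in> B (Suc n)" using x unfolding B_def by (auto intro: order_trans)
    qed
    then have "(SUP n. emeasure ?N (B n)) = emeasure ?N {x\<in>A. 0 < h x}"
      using Bb by (subst SUP_emeasure_incseq) (auto simp: UB)
    moreover have "{x\<in>A. 0 < h x} \<in> sets borel" using Bb unfolding UB[symmetric] by (intro sets.countable_UN) auto
    then have "emeasure ?N {x\<in>A. 0 < h x} = emeasure ?N A"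
      unfolding em[OF A] by (subst em) (auto intro!: nn_integral_cong simp: indicator_def zero_less_iff_neq_zero)
    moreover have "(SUP n. emeasure ?N (B n)) \<le> ?S" by (intro SUP_least BS)
    ultimately show "emeasure ?N A \<le> ?S" by (simp only:)
  qed
  moreover have "emeasure ?N UNIV < \<infinity>" using em[of UNIV] fin by simp
  ultimately show ?thesis unfolding finite_radon_def by simp
qed

section \<open>Tonelli's formula for convolutions\<close>

lemma shift_measurable[measurable]:
  assumes "g \<in> borel_measurable borel" shows "(\<lambda>y. g (- y + x)) \<in> borel_measurable (borel :: 'g measure)"
proof -
  have "(\<lambda>y. - y + x) \<in> borel_measurable (borel :: 'g measure)"
    by (intro borel_measurable_continuous_onI continuous_intros)
  from measurable_compose[OF this assms] show ?thesis .
qed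

lemma translate_measurable[measurable]:
  assumes "g \<in> borel_measurable borel" shows "(\<lambda>y. g (x + y)) \<in> borel_measurable (borel :: 'g measure)"
proof -
  have "(\<lambda>y. x + y) \<in> borel_measurable (borel :: 'g measure)"
    by (intro borel_measurable_continuous_onI continuous_intros)
  from measurable_compose[OF this assms] show ?thesis .
qed

text \<open>
  Finiteness of the integral cannot be dropped: outer regularity gives infinite measure to some
  locally null sets when \<open>G\<close> is not \<open>\<sigma>\<close>-compact.
\<close>

lemma nn_integral_slice:
  fixes g :: "'g \<Rightarrow> ennreal"
  assumes N: "finite_radon N" and g: "g \<in> borel_measurable borel"
  shows "(\<lambda>x. \<integral>\<^sup>+y. g (- y + x) \<partial>N) \<in> borel_measurable borel \<and>
    ((\<integral>\<^sup>+x. g x \<partial>M) < \<infinity> \<longrightarrow> (\<integral>\<^sup>+x. (\<integral>\<^sup>+y. g (- y + x) \<partial>N) \<partial>M) = emeasure N UNIV * (\<integral>\<^sup>+x. g x \<partial>M))"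
proof -
  have sN[measurable_cong, simp]: "sets N = sets borel" using N unfolding finite_radon_def by auto
  have bM: "borel_measurable N = borel_measurable borel" "borel_measurable M = borel_measurable borel"
    by (auto intro!: measurable_cong_sets)
  show ?thesis
    using g
  proof (induction rule: borel_measurable_induct)
    case (cong f g)
    then have "f = g" by auto
    with cong show ?case by simp
  next
    case (set A)
    have "(\<integral>\<^sup>+y. indicator A (- y + x) \<partial>N) = emeasure N {y. - y + x \<in> A}" for x
    proof -
      have "(\<integral>\<^sup>+y. indicator A (- y + x) \<partial>N) = (\<integral>\<^sup>+y. indicator {y. - y + x \<in> A} y \<partial>N)"
        by (intro nn_integral_cong) (auto simp: indicator_def)
      then show ?thesis using slice_borel[OF set, of x] by simp
    qed
    then show ?case using set slice_measurable[OF N _ set, of UNIV] slice_integral_borel[OF N set]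
      by simp
  next
    case (mult u c)
    have 1: "(\<integral>\<^sup>+y. c * u (- y + x) \<partial>N) = c * (\<integral>\<^sup>+y. u (- y + x) \<partial>N)" for x
      using mult(2) by (intro nn_integral_cmult) (auto simp: bM)
    have 2: "(\<integral>\<^sup>+x. c * u x \<partial>M) = c * (\<integral>\<^sup>+x. u x \<partial>M)"
      using mult(2) by (intro nn_integral_cmult) (auto simp: bM)
    have 3: "(\<integral>\<^sup>+x. c * (\<integral>\<^sup>+y. u (- y + x) \<partial>N) \<partial>M) = c * (\<integral>\<^sup>+x. (\<integral>\<^sup>+y. u (- y + x) \<partial>N) \<partial>M)"
      using mult.IH by (intro nn_integral_cmult) (auto simp: bM)
    show ?case
    proof (cases "c = 0")
      case False
      then have "(\<integral>\<^sup>+x. u x \<partial>M) < \<infinity>" if "c * (\<integral>\<^sup>+x. u x \<partial>M) < \<infinity>"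
        using that by (auto simp: ennreal_mult_less_top)
      with mult.IH have "(\<integral>\<^sup>+x. (\<integral>\<^sup>+y. u (- y + x) \<partial>N) \<partial>M) = emeasure N UNIV * (\<integral>\<^sup>+x. u x \<partial>M)"
        if "c * (\<integral>\<^sup>+x. u x \<partial>M) < \<infinity>" using that by blast
      moreover have "(\<lambda>x. c * (\<integral>\<^sup>+y. u (- y + x) \<partial>N)) \<in> borel_measurable borel"
        using mult.IH by (intro borel_measurable_times_ennreal borel_measurable_const) blast
      ultimately show ?thesis unfolding 1 2 3 by (auto simp only: mult.left_commute)
    next
      case True then show ?thesis by simp
    qed
  next
    case (add u v)
    have 1: "(\<integral>\<^sup>+y. v (- y + x) + u (- y + x) \<partial>N) = (\<integral>\<^sup>+y. v (- y + x) \<partial>N) + (\<integral>\<^sup>+y. u (- y + x) \<partial>N)" for x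
      using add by (intro nn_integral_add) (auto simp: bM)
    have 2: "(\<integral>\<^sup>+x. v x + u x \<partial>M) = (\<integral>\<^sup>+x. v x \<partial>M) + (\<integral>\<^sup>+x. u x \<partial>M)"
      using add by (intro nn_integral_add) (auto simp: bM)
    show ?case unfolding 1 2 using add
      by (auto simp: nn_integral_add bM distrib_left)
  next
    case (seq U)
    have 1: "(\<integral>\<^sup>+y. (SUP i. U i) (- y + x) \<partial>N) = (SUP i. (\<integral>\<^sup>+y. U i (- y + x) \<partial>N))" for x
    proof -
      have "(\<integral>\<^sup>+y. (SUP i. U i) (- y + x) \<partial>N) = (\<integral>\<^sup>+y. (SUP i. U i (- y + x)) \<partial>N)"
        by (simp add: image_comp)
      also have "\<dots> = (SUP i. (\<integral>\<^sup>+y. U i (- y + x) \<partial>N))"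
        using seq by (intro nn_integral_monotone_convergence_SUP) (auto simp: bM incseq_def le_fun_def)
      finally show ?thesis .
    qed
    have 2: "(\<integral>\<^sup>+y. (SUP i. U i) y \<partial>M) = (SUP i. (\<integral>\<^sup>+y. U i y \<partial>M))"
    proof -
      have "(\<integral>\<^sup>+y. (SUP i. U i) y \<partial>M) = (\<integral>\<^sup>+y. (SUP i. U i y) \<partial>M)"
        by (simp add: image_comp)
      also have "\<dots> = (SUP i. (\<integral>\<^sup>+y. U i y \<partial>M))"
        using seq by (intro nn_integral_monotone_convergence_SUP) (auto simp: bM)
      finally show ?thesis .
    qed
    have m: "(\<lambda>x. SUP i. (\<integral>\<^sup>+y. U i (- y + x) \<partial>N)) \<in> borel_measurable borel"
      using seq by (intro borel_measurable_SUP) auto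
    have "(\<integral>\<^sup>+x. (SUP i. \<integral>\<^sup>+y. U i (- y + x) \<partial>N) \<partial>M) = emeasure N UNIV * (SUP i. (\<integral>\<^sup>+y. U i y \<partial>M))"
      if fin: "(SUP i. (\<integral>\<^sup>+y. U i y \<partial>M)) < \<infinity>"
    proof -
      have f: "(\<integral>\<^sup>+y. U i y \<partial>M) < \<infinity>" for i
        using fin by (meson SUP_upper UNIV_I le_less_trans)
      have "(\<integral>\<^sup>+x. (SUP i. \<integral>\<^sup>+y. U i (- y + x) \<partial>N) \<partial>M) = (SUP i. \<integral>\<^sup>+x. (\<integral>\<^sup>+y. U i (- y + x) \<partial>N) \<partial>M)"
        using seq by (intro nn_integral_monotone_convergence_SUP)
          (auto simp: bM incseq_def le_fun_def intro!: nn_integral_mono)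
      also have "\<dots> = (SUP i. emeasure N UNIV * (\<integral>\<^sup>+y. U i y \<partial>M))"
        using seq f by simp
      finally show ?thesis by (simp add: SUP_mult_left_ennreal)
    qed
    with m show ?case unfolding 1 2 by blast
  qed
qed

text \<open>The slice formula for the finite Radon measure with density \<open>f\<close>, whose
  total mass is the integral of \<open>f\<close>.\<close>

lemma
  fixes f g :: "'g \<Rightarrow> ennreal"
  assumes f[measurable]: "f \<in> borel_measurable borel" and g[measurable]: "g \<in> borel_measurable borel"
    and fin: "(\<integral>\<^sup>+x. f x \<partial>M) < \<infinity>"
  shows nn_conv_measurable: "(\<lambda>x. \<integral>\<^sup>+y. f y * g (- y + x) \<partial>M) \<in> borel_measurable borel"
    and nn_conv_integral: "(\<integral>\<^sup>+x. g x \<partial>M) < \<infinity> \<Longrightarrow>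
      (\<integral>\<^sup>+x. (\<integral>\<^sup>+y. f y * g (- y + x) \<partial>M) \<partial>M) = (\<integral>\<^sup>+x. f x \<partial>M) * (\<integral>\<^sup>+x. g x \<partial>M)"
proof -
  have 1: "(\<integral>\<^sup>+y. g (- y + x) \<partial>density M f) = (\<integral>\<^sup>+y. f y * g (- y + x) \<partial>M)" for x
    by (subst nn_integral_density) auto
  have 2: "emeasure (density M f) UNIV = (\<integral>\<^sup>+x. f x \<partial>M)"
    by (subst emeasure_density) auto
  note * = nn_integral_slice[OF finite_radon_density[OF f fin] g, unfolded 1 2]
  show "(\<lambda>x. \<integral>\<^sup>+y. f y * g (- y + x) \<partial>M) \<in> borel_measurable borel" using * by blast
  show "(\<integral>\<^sup>+x. g x \<partial>M) < \<infinity> \<Longrightarrow>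
      (\<integral>\<^sup>+x. (\<integral>\<^sup>+y. f y * g (- y + x) \<partial>M) \<partial>M) = (\<integral>\<^sup>+x. f x \<partial>M) * (\<integral>\<^sup>+x. g x \<partial>M)" using * by blast
qed

end

subsection \<open>Convolution of integrable functions\<close>

text \<open>For \<open>e = 1\<close>, \<open>-1\<close>, \<open>-\<i>\<close>, \<open>\<i>\<close>
  these are the positive and negative parts of \<open>Re z\<close> and the positive and negative
  parts of \<open>Im z\<close>. The unimodular parameter allows the four to be treated at
  once.\<close>

definition cpart :: "complex \<Rightarrow> complex \<Rightarrow> real" where
  "cpart e z = max 0 (Re (e * z))"

lemma cpart_nonneg: "0 \<le> cpart e z"
  by (simp add: cpart_def)

lemma cpart_le: "cmod e = 1 \<Longrightarrow> cpart e z \<le> cmod z"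
  using abs_Re_le_cmod[of "e * z"] by (simp add: cpart_def norm_mult)

lemma cpart_measurable[measurable]: "f \<in> borel_measurable N \<Longrightarrow> (\<lambda>x. cpart e (f x)) \<in> borel_measurable N"
  unfolding cpart_def by (intro borel_measurable_max borel_measurable_const) measurable

lemma cpart_decomp: "complex_of_real (cpart 1 z) - of_real (cpart (-1) z)
    + \<i> * (of_real (cpart (-\<i>) z) - of_real (cpart \<i> z)) = z"
  by (auto simp: cpart_def complex_eq_iff max_def)

lemma integral_decomp:
  fixes a b c d :: "'a \<Rightarrow> complex"
  assumes "integrable N a" "integrable N b" "integrable N c" "integrable N d"
  shows "(LINT x|N. a x - b x + \<i> * (c x - d x)) = (LINT x|N. a x) - (LINT x|N. b x) + \<i> * ((LINT x|N. c x) - (LINT x|N. d x))"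
  using assms by simp

lemma integrable_cpart:
  assumes "integrable N (f :: 'a \<Rightarrow> complex)" "cmod e = 1"
  shows "integrable N (\<lambda>x. complex_of_real (cpart e (f x)))"
  by (rule Bochner_Integration.integrable_bound[OF assms(1)])
    (use assms borel_measurable_integrable[OF assms(1)] in \<open>auto simp: cpart_nonneg cpart_le\<close>)

context haar_group
begin

lemma borel_measurable_M: "borel_measurable M = borel_measurable borel"
  by (auto intro!: measurable_cong_sets)

lemma conv_integrand_measurable:
  assumes "f \<in> borel_measurable borel" "g \<in> borel_measurable borel"
  shows "(\<lambda>y. f y * g (- y + x) :: complex) \<in> borel_measurable M"
  using assms unfolding borel_measurable_M by measurable

lemma conv_integrable_iff:
  assumes "f \<in> borel_measurable borel" "g \<in> borel_measurable borel"
  shows "integrable M (\<lambda>y. f y * g (- y + x) :: complex) \<longleftrightarrow>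
    (\<integral>\<^sup>+y. ennreal (cmod (f y)) * ennreal (cmod (g (- y + x))) \<partial>M) < \<infinity>"
  using conv_integrand_measurable[OF assms] by (simp add: integrable_iff_bounded norm_mult ennreal_mult)

text \<open>Restricted to points of integrability: elsewhere \<open>conv M f g x\<close> is the
  default value 0, while some of the four parts may converge to nonzero values.\<close>

lemma conv_decomp_left:
  assumes f: "f \<in> borel_measurable borel" and g: "g \<in> borel_measurable borel"
    and i: "integrable M (\<lambda>y. f y * g (- y + x))"
  shows "conv M f g x = conv M (\<lambda>y. of_real (cpart 1 (f y))) g x - conv M (\<lambda>y. of_real (cpart (-1) (f y))) g x
    + \<i> * (conv M (\<lambda>y. of_real (cpart (-\<i>) (f y))) g x - conv M (\<lambda>y. of_real (cpart \<i> (f y))) g x)"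
proof -
  have p: "integrable M (\<lambda>y. complex_of_real (cpart e (f y)) * g (- y + x))" if "cmod e = 1" for e
  proof (rule Bochner_Integration.integrable_bound[OF i])
    show "(\<lambda>y. complex_of_real (cpart e (f y)) * g (- y + x)) \<in> borel_measurable M"
      by (rule conv_integrand_measurable) (use f g in measurable)
  qed (use cpart_le[OF that] cpart_nonneg in \<open>auto simp: norm_mult intro!: mult_right_mono AE_I2\<close>)
  show ?thesis
    unfolding conv_def
    by (subst integral_decomp[symmetric])
      (auto intro!: p Bochner_Integration.integral_cong simp: left_diff_distrib[symmetric] distrib_right[symmetric] mult.assoc[symmetric]
        right_diff_distrib[symmetric] cpart_decomp)
qed

lemma conv_decomp_right:
  assumes f: "f \<in> borel_measurable borel" and g: "g \<in> borel_measurable borel"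
    and i: "integrable M (\<lambda>y. f y * g (- y + x))"
  shows "conv M f g x = conv M f (\<lambda>y. of_real (cpart 1 (g y))) x - conv M f (\<lambda>y. of_real (cpart (-1) (g y))) x
    + \<i> * (conv M f (\<lambda>y. of_real (cpart (-\<i>) (g y))) x - conv M f (\<lambda>y. of_real (cpart \<i> (g y))) x)"
proof -
  have p: "integrable M (\<lambda>y. f y * complex_of_real (cpart e (g (- y + x))))" if "cmod e = 1" for e
  proof (rule Bochner_Integration.integrable_bound[OF i])
    show "(\<lambda>y. f y * complex_of_real (cpart e (g (- y + x)))) \<in> borel_measurable M"
      using conv_integrand_measurable[of f "\<lambda>y. of_real (cpart e (g y))" x] f g by measurable
  qed (use cpart_le[OF that] cpart_nonneg in \<open>auto simp: norm_mult intro!: mult_left_mono AE_I2\<close>)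
  have "(LINT y|M. f y * g (- y + x)) = (LINT y|M. f y * of_real (cpart 1 (g (- y + x))) - f y * of_real (cpart (-1) (g (- y + x)))
    + \<i> * (f y * of_real (cpart (-\<i>) (g (- y + x))) - f y * of_real (cpart \<i> (g (- y + x)))))"
  proof (rule Bochner_Integration.integral_cong[OF refl])
    fix y
    show "f y * g (- y + x) = f y * of_real (cpart 1 (g (- y + x))) - f y * of_real (cpart (-1) (g (- y + x)))
      + \<i> * (f y * of_real (cpart (-\<i>) (g (- y + x))) - f y * of_real (cpart \<i> (g (- y + x))))"
      by (subst cpart_decomp[of "g (- y + x)", symmetric]) (simp only: algebra_simps)
  qed
  also have "\<dots> = (LINT y|M. f y * of_real (cpart 1 (g (- y + x)))) - (LINT y|M. f y * of_real (cpart (-1) (g (- y + x))))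
    + \<i> * ((LINT y|M. f y * of_real (cpart (-\<i>) (g (- y + x)))) - (LINT y|M. f y * of_real (cpart \<i> (g (- y + x)))))"
    by (intro integral_decomp p) auto
  finally show ?thesis unfolding conv_def .
qed

text \<open>Valid at every \<open>x\<close>: where the nonnegative integral is infinite,
  \<open>enn2real\<close> gives 0, which is also the default value of the Bochner integral.\<close>

lemma conv_real:
  fixes u v :: "'g \<Rightarrow> real"
  assumes u: "u \<in> borel_measurable borel" "\<And>x. 0 \<le> u x" and v: "v \<in> borel_measurable borel" "\<And>x. 0 \<le> v x"
  shows "conv M (\<lambda>y. of_real (u y)) (\<lambda>y. of_real (v y)) x
    = of_real (enn2real (\<integral>\<^sup>+y. ennreal (u y) * ennreal (v (- y + x)) \<partial>M))"
proof -
  have m: "(\<lambda>y. u y * v (- y + x)) \<in> borel_measurable M"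
    unfolding borel_measurable_M using u v by measurable
  have "conv M (\<lambda>y. of_real (u y)) (\<lambda>y. of_real (v y)) x = of_real (LINT y|M. u y * v (- y + x))"
    unfolding conv_def of_real_mult[symmetric] by (rule integral_complex_of_real)
  also have "(LINT y|M. u y * v (- y + x)) = enn2real (\<integral>\<^sup>+y. ennreal (u y * v (- y + x)) \<partial>M)"
    using m u v by (intro integral_eq_nn_integral) auto
  finally show ?thesis using u v by (simp add: ennreal_mult)
qed

text \<open>The set of points where the convolution integral converges is Borel by
  \<open>nn_conv_measurable\<close>, and off this set the convolution is 0. So a measurable formula
  \<open>q\<close> on that set is enough.\<close>

lemma conv_measurable_aux:
  fixes f g :: "'g \<Rightarrow> complex" and q :: "'g \<Rightarrow> complex"
  assumes f: "f \<in> borel_measurable borel" "integrable M f" and g: "g \<in> borel_measurable borel"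
    and q: "q \<in> borel_measurable borel" "\<And>x. integrable M (\<lambda>y. f y * g (- y + x)) \<Longrightarrow> conv M f g x = q x"
  shows "conv M f g \<in> borel_measurable borel"
proof -
  have "(\<integral>\<^sup>+y. ennreal (cmod (f y)) \<partial>M) < \<infinity>"
    using f(2) by (simp add: integrable_iff_bounded)
  then have D: "(\<lambda>x. \<integral>\<^sup>+y. ennreal (cmod (f y)) * ennreal (cmod (g (- y + x))) \<partial>M) \<in> borel_measurable borel"
    using f g by (intro nn_conv_measurable) auto
  have eq: "conv M f g x = (if (\<integral>\<^sup>+y. ennreal (cmod (f y)) * ennreal (cmod (g (- y + x))) \<partial>M) < \<infinity> then q x else 0)" for x
    using q(2)[of x] conv_integrable_iff[OF f(1) g, of x] by (auto simp: conv_def not_integrable_integral_eq)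
  show ?thesis
    unfolding eq[abs_def] using D q(1) by measurable
qed

text \<open>Reduction to nonnegative functions, one factor at a time: first both factors
  nonnegative, then only the left one, then none.\<close>

lemma conv_measurable:
  fixes f g :: "'g \<Rightarrow> complex"
  assumes f: "integrable M f" and g: "g \<in> borel_measurable borel"
  shows "conv M f g \<in> borel_measurable borel"
proof -
  have 1: "conv M (\<lambda>y. of_real (u y)) (\<lambda>y. of_real (v y)) \<in> borel_measurable borel"
    if "integrable M (\<lambda>x. complex_of_real (u x))" "u \<in> borel_measurable borel" "\<And>x. 0 \<le> u x"
       "v \<in> borel_measurable borel" "\<And>x. 0 \<le> v x" for u v
  proof -
    have "(\<integral>\<^sup>+y. ennreal (u y) \<partial>M) < \<infinity>" using that(1,3) by (simp add: integrable_iff_bounded)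
    then have "(\<lambda>x. \<integral>\<^sup>+y. ennreal (u y) * ennreal (v (- y + x)) \<partial>M) \<in> borel_measurable borel"
      using that by (intro nn_conv_measurable) auto
    then show ?thesis unfolding conv_real[OF that(2-5), abs_def] by measurable
  qed
  have fm: "f \<in> borel_measurable borel"
    using borel_measurable_integrable[OF f] by (simp add: borel_measurable_M)
  have 2: "conv M (\<lambda>y. of_real (u y)) g \<in> borel_measurable borel"
    if u: "integrable M (\<lambda>x. complex_of_real (u x))" "u \<in> borel_measurable borel" "\<And>x. 0 \<le> u x" for u
  proof (rule conv_measurable_aux[OF _ u(1) g])
    show um: "(\<lambda>x. complex_of_real (u x)) \<in> borel_measurable borel" using u by measurable
    show "conv M (\<lambda>y. of_real (u y)) g x = conv M (\<lambda>y. of_real (u y)) (\<lambda>y. of_real (cpart 1 (g y))) x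
      - conv M (\<lambda>y. of_real (u y)) (\<lambda>y. of_real (cpart (-1) (g y))) x
      + \<i> * (conv M (\<lambda>y. of_real (u y)) (\<lambda>y. of_real (cpart (-\<i>) (g y))) x
        - conv M (\<lambda>y. of_real (u y)) (\<lambda>y. of_real (cpart \<i> (g y))) x)"
      if "integrable M (\<lambda>y. of_real (u y) * g (- y + x))" for x
      by (rule conv_decomp_right[OF um g that])
    have "conv M (\<lambda>y. of_real (u y)) (\<lambda>y. of_real (cpart e (g y))) \<in> borel_measurable borel" for e
      by (rule 1[OF u]) (use g in \<open>auto simp: cpart_nonneg\<close>)
    then show "(\<lambda>x. conv M (\<lambda>y. of_real (u y)) (\<lambda>y. of_real (cpart 1 (g y))) x
      - conv M (\<lambda>y. of_real (u y)) (\<lambda>y. of_real (cpart (-1) (g y))) x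
      + \<i> * (conv M (\<lambda>y. of_real (u y)) (\<lambda>y. of_real (cpart (-\<i>) (g y))) x
        - conv M (\<lambda>y. of_real (u y)) (\<lambda>y. of_real (cpart \<i> (g y))) x)) \<in> borel_measurable borel"
      by (intro borel_measurable_add borel_measurable_diff borel_measurable_times borel_measurable_const)
  qed
  show ?thesis
  proof (rule conv_measurable_aux[OF fm f g])
    show "conv M f g x = conv M (\<lambda>y. of_real (cpart 1 (f y))) g x - conv M (\<lambda>y. of_real (cpart (-1) (f y))) g x
      + \<i> * (conv M (\<lambda>y. of_real (cpart (-\<i>) (f y))) g x - conv M (\<lambda>y. of_real (cpart \<i> (f y))) g x)"
      if "integrable M (\<lambda>y. f y * g (- y + x))" for x
      by (rule conv_decomp_left[OF fm g that])
    have "conv M (\<lambda>y. of_real (cpart e (f y))) g \<in> borel_measurable borel" if "cmod e = 1" for e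
      by (rule 2) (use fm f that in \<open>auto simp: cpart_nonneg intro!: integrable_cpart\<close>)
    then show "(\<lambda>x. conv M (\<lambda>y. of_real (cpart 1 (f y))) g x - conv M (\<lambda>y. of_real (cpart (-1) (f y))) g x
      + \<i> * (conv M (\<lambda>y. of_real (cpart (-\<i>) (f y))) g x - conv M (\<lambda>y. of_real (cpart \<i> (f y))) g x)) \<in> borel_measurable borel"
      by (intro borel_measurable_add borel_measurable_diff borel_measurable_times borel_measurable_const) auto
  qed
qed

lemma norm_conv_le:
  assumes f: "f \<in> borel_measurable borel" and g: "g \<in> borel_measurable borel"
  shows "ennreal (cmod (conv M f g x)) \<le> (\<integral>\<^sup>+y. ennreal (cmod (f y)) * ennreal (cmod (g (- y + x))) \<partial>M)"
proof (cases "integrable M (\<lambda>y. f y * g (- y + x))")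
  case True
  have "ennreal (cmod (conv M f g x)) \<le> (\<integral>\<^sup>+y. ennreal (cmod (f y * g (- y + x))) \<partial>M)"
    unfolding conv_def by (rule integral_norm_bound_ennreal[OF True])
  then show ?thesis by (simp add: norm_mult ennreal_mult)
qed (simp add: conv_def not_integrable_integral_eq)

text \<open>The convolution of the moduli has finite integral by Tonelli's formula, so it is finite
  almost everywhere, and it dominates the modulus of the convolution.\<close>

lemma
  fixes f g :: "'g \<Rightarrow> complex"
  assumes f: "integrable M f" and g: "integrable M g"
  shows conv_integrable_AE: "AE x in M. integrable M (\<lambda>y. f y * g (- y + x))"
    and integrable_conv: "integrable M (conv M f g)"
proof -
  have fm: "f \<in> borel_measurable borel" and gm: "g \<in> borel_measurable borel"
    using borel_measurable_integrable[OF f] borel_measurable_integrable[OF g] by (simp_all add: borel_measurable_M)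
  have ff: "(\<integral>\<^sup>+y. ennreal (cmod (f y)) \<partial>M) < \<infinity>" and gf: "(\<integral>\<^sup>+y. ennreal (cmod (g y)) \<partial>M) < \<infinity>"
    using f g by (simp_all add: integrable_iff_bounded)
  let ?I = "\<lambda>x. \<integral>\<^sup>+y. ennreal (cmod (f y)) * ennreal (cmod (g (- y + x))) \<partial>M"
  have I: "?I \<in> borel_measurable M" unfolding borel_measurable_M
    using fm gm ff by (intro nn_conv_measurable) auto
  have "(\<integral>\<^sup>+x. ?I x \<partial>M) = (\<integral>\<^sup>+y. ennreal (cmod (f y)) \<partial>M) * (\<integral>\<^sup>+y. ennreal (cmod (g y)) \<partial>M)"
    using fm gm ff gf by (intro nn_conv_integral) auto
  then have fin: "(\<integral>\<^sup>+x. ?I x \<partial>M) < \<infinity>" using ff gf by (simp add: ennreal_mult_less_top)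
  then have "AE x in M. ?I x \<noteq> \<infinity>" using I by (intro nn_integral_PInf_AE) auto
  then show "AE x in M. integrable M (\<lambda>y. f y * g (- y + x))"
    by eventually_elim (simp add: conv_integrable_iff[OF fm gm] less_top)
  have "(\<integral>\<^sup>+x. ennreal (cmod (conv M f g x)) \<partial>M) \<le> (\<integral>\<^sup>+x. ?I x \<partial>M)"
    by (intro nn_integral_mono norm_conv_le fm gm)
  then show "integrable M (conv M f g)"
    using fin conv_measurable[OF f gm] by (simp add: integrable_iff_bounded borel_measurable_M)
qed

text \<open>Integration is a character of L1(G), so under \<open>id \<otimes> \<integral>\<close>
  the right action of \<open>p\<close> becomes multiplication by the integral of \<open>p\<close>.
  Tonelli's formula gives the nonnegative case, and the four-part decomposition of each factor gives
  the rest.\<close>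

lemma integral_conv:
  fixes f g :: "'g \<Rightarrow> complex"
  assumes f: "integrable M f" and g: "integrable M g"
  shows "(LINT x|M. conv M f g x) = (LINT x|M. f x) * (LINT x|M. g x)"
proof -
  have bm: "h \<in> borel_measurable borel" if "integrable M h" for h :: "'g \<Rightarrow> complex"
    using borel_measurable_integrable[OF that] by (simp add: borel_measurable_M)
  have 1: "(LINT x|M. conv M (\<lambda>y. of_real (u y)) (\<lambda>y. of_real (v y)) x) = (LINT x|M. of_real (u x)) * (LINT x|M. of_real (v x))"
    if u: "integrable M (\<lambda>x. complex_of_real (u x))" "u \<in> borel_measurable borel" "\<And>x. 0 \<le> u x"
      and v: "integrable M (\<lambda>x. complex_of_real (v x))" "v \<in> borel_measurable borel" "\<And>x. 0 \<le> v x" for u v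
  proof -
    let ?I = "\<lambda>x. \<integral>\<^sup>+y. ennreal (u y) * ennreal (v (- y + x)) \<partial>M"
    have uf: "(\<integral>\<^sup>+y. ennreal (u y) \<partial>M) < \<infinity>" and vf: "(\<integral>\<^sup>+y. ennreal (v y) \<partial>M) < \<infinity>"
      using u(1,3) v(1,3) by (simp_all add: integrable_iff_bounded)
    have I: "?I \<in> borel_measurable M" unfolding borel_measurable_M
      using u v uf by (intro nn_conv_measurable) auto
    have eq: "(\<integral>\<^sup>+x. ?I x \<partial>M) = (\<integral>\<^sup>+y. ennreal (u y) \<partial>M) * (\<integral>\<^sup>+y. ennreal (v y) \<partial>M)"
      using u v uf vf by (intro nn_conv_integral) auto
    then have "(\<integral>\<^sup>+x. ?I x \<partial>M) < \<infinity>" using uf vf by (simp add: ennreal_mult_less_top)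
    then have "AE x in M. ?I x \<noteq> \<infinity>" using I by (intro nn_integral_PInf_AE) auto
    then have ae: "AE x in M. ennreal (enn2real (?I x)) = ?I x"
      by eventually_elim (simp add: less_top)
    have "(LINT x|M. conv M (\<lambda>y. of_real (u y)) (\<lambda>y. of_real (v y)) x) = of_real (LINT x|M. enn2real (?I x))"
      unfolding conv_real[OF u(2,3) v(2,3)] by (rule integral_complex_of_real)
    also have "(LINT x|M. enn2real (?I x)) = enn2real (\<integral>\<^sup>+x. ennreal (enn2real (?I x)) \<partial>M)"
      using I by (intro integral_eq_nn_integral) auto
    also have "(\<integral>\<^sup>+x. ennreal (enn2real (?I x)) \<partial>M) = (\<integral>\<^sup>+x. ?I x \<partial>M)"
      by (rule nn_integral_cong_AE[OF ae])
    also have "enn2real \<dots> = (LINT x|M. u x) * (LINT x|M. v x)"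
      unfolding eq enn2real_mult using u v
      by (simp add: integral_eq_nn_integral borel_measurable_M)
    finally show ?thesis by (simp add: integral_complex_of_real)
  qed
  have 2: "(LINT x|M. conv M (\<lambda>y. of_real (u y)) g x) = (LINT x|M. of_real (u x)) * (LINT x|M. g x)"
    if u: "integrable M (\<lambda>x. complex_of_real (u x))" "u \<in> borel_measurable borel" "\<And>x. 0 \<le> u x" for u
  proof -
    let ?g = "\<lambda>e y. complex_of_real (cpart e (g y))" and ?u = "\<lambda>y. complex_of_real (u y)"
    have gi: "integrable M (?g e)" if "cmod e = 1" for e using integrable_cpart[OF g that] .
    have ci: "integrable M (conv M ?u (?g e))" if "cmod e = 1" for e by (rule integrable_conv[OF u(1) gi[OF that]])
    have "(LINT x|M. conv M ?u g x) = (LINT x|M. conv M ?u (?g 1) x - conv M ?u (?g (-1)) x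
      + \<i> * (conv M ?u (?g (-\<i>)) x - conv M ?u (?g \<i>) x))"
    proof (rule integral_cong_AE)
      show "AE x in M. conv M ?u g x = conv M ?u (?g 1) x - conv M ?u (?g (-1)) x
        + \<i> * (conv M ?u (?g (-\<i>)) x - conv M ?u (?g \<i>) x)"
        using conv_integrable_AE[OF u(1) g]
        by eventually_elim (rule conv_decomp_right[OF bm[OF u(1)] bm[OF g]])
      show "conv M ?u g \<in> borel_measurable M" using integrable_conv[OF u(1) g] by simp
      show "(\<lambda>x. conv M ?u (?g 1) x - conv M ?u (?g (-1)) x
        + \<i> * (conv M ?u (?g (-\<i>)) x - conv M ?u (?g \<i>) x)) \<in> borel_measurable M"
        by (intro borel_measurable_add borel_measurable_diff borel_measurable_times borel_measurable_const
            borel_measurable_integrable ci) auto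
    qed
    also have "\<dots> = (LINT x|M. conv M ?u (?g 1) x) - (LINT x|M. conv M ?u (?g (-1)) x)
      + \<i> * ((LINT x|M. conv M ?u (?g (-\<i>)) x) - (LINT x|M. conv M ?u (?g \<i>) x))"
      by (intro integral_decomp ci) auto
    also have "\<dots> = (LINT x|M. ?u x) * ((LINT x|M. ?g 1 x) - (LINT x|M. ?g (-1) x)
      + \<i> * ((LINT x|M. ?g (-\<i>) x) - (LINT x|M. ?g \<i> x)))"
    proof -
      have "(LINT x|M. conv M ?u (?g e) x) = (LINT x|M. ?u x) * (LINT x|M. ?g e x)" if "cmod e = 1" for e
        by (rule 1[OF u gi[OF that]]) (use bm[OF g] in \<open>auto simp: cpart_nonneg\<close>)
      then show ?thesis by (simp only: norm_one norm_minus_cancel norm_ii) (simp add: algebra_simps)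
    qed
    also have "(LINT x|M. ?g 1 x) - (LINT x|M. ?g (-1) x) + \<i> * ((LINT x|M. ?g (-\<i>) x) - (LINT x|M. ?g \<i> x))
      = (LINT x|M. g x)"
      by (subst integral_decomp[symmetric]) (auto intro!: gi simp: cpart_decomp)
    finally show ?thesis .
  qed
  let ?f = "\<lambda>e y. complex_of_real (cpart e (f y))"
  have fi: "integrable M (?f e)" if "cmod e = 1" for e using integrable_cpart[OF f that] .
  have ci: "integrable M (conv M (?f e) g)" if "cmod e = 1" for e by (rule integrable_conv[OF fi[OF that] g])
  have "(LINT x|M. conv M f g x) = (LINT x|M. conv M (?f 1) g x - conv M (?f (-1)) g x
    + \<i> * (conv M (?f (-\<i>)) g x - conv M (?f \<i>) g x))"
  proof (rule integral_cong_AE)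
    show "AE x in M. conv M f g x = conv M (?f 1) g x - conv M (?f (-1)) g x
      + \<i> * (conv M (?f (-\<i>)) g x - conv M (?f \<i>) g x)"
      using conv_integrable_AE[OF f g]
      by eventually_elim (rule conv_decomp_left[OF bm[OF f] bm[OF g]])
    show "conv M f g \<in> borel_measurable M" using integrable_conv[OF f g] by simp
    show "(\<lambda>x. conv M (?f 1) g x - conv M (?f (-1)) g x
      + \<i> * (conv M (?f (-\<i>)) g x - conv M (?f \<i>) g x)) \<in> borel_measurable M"
      by (intro borel_measurable_add borel_measurable_diff borel_measurable_times borel_measurable_const
          borel_measurable_integrable ci) auto
  qed
  also have "\<dots> = (LINT x|M. conv M (?f 1) g x) - (LINT x|M. conv M (?f (-1)) g x)
    + \<i> * ((LINT x|M. conv M (?f (-\<i>)) g x) - (LINT x|M. conv M (?f \<i>) g x))"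
    by (intro integral_decomp ci) auto
  also have "\<dots> = ((LINT x|M. ?f 1 x) - (LINT x|M. ?f (-1) x)
    + \<i> * ((LINT x|M. ?f (-\<i>) x) - (LINT x|M. ?f \<i> x))) * (LINT x|M. g x)"
  proof -
    have "(LINT x|M. conv M (?f e) g x) = (LINT x|M. ?f e x) * (LINT x|M. g x)" if "cmod e = 1" for e
      by (rule 2[OF fi[OF that]]) (use bm[OF f] in \<open>auto simp: cpart_nonneg\<close>)
    then show ?thesis by (simp only: norm_one norm_minus_cancel norm_ii) (simp add: algebra_simps)
  qed
  also have "(LINT x|M. ?f 1 x) - (LINT x|M. ?f (-1) x) + \<i> * ((LINT x|M. ?f (-\<i>) x) - (LINT x|M. ?f \<i> x))
    = (LINT x|M. f x)"
    by (subst integral_decomp[symmetric]) (auto intro!: fi simp: cpart_decomp)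
  finally show ?thesis .
qed

section \<open>Left translation\<close>

lemma translate_measurable_M: "(+) s \<in> measurable M M"
proof -
  have "(+) s \<in> borel_measurable (borel :: 'g measure)"
    by (intro borel_measurable_continuous_onI continuous_intros)
  then show ?thesis by (simp add: measurable_cong_sets[OF sets_M sets_M])
qed

lemma distr_translate: "distr M M ((+) s) = M"
proof (rule measure_eqI)
  fix A assume "A \<in> sets (distr M M ((+) s))"
  then have A: "A \<in> sets borel" by simp
  have "(+) s -` A = (+) (- s) ` A"
    by (auto simp: image_iff) (metis add_minus_cancel minus_add_cancel)+
  then show "emeasure (distr M M ((+) s)) A = emeasure M A"
    using A translate_measurable_M[of s] emeasure_translate[OF A, of "- s"] by (simp add: emeasure_distr)
qed simp

lemma integral_translate:
  fixes f :: "'g \<Rightarrow> 'b::{banach, second_countable_topology}"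
  assumes "f \<in> borel_measurable M"
  shows "(LINT x|M. f (s + x)) = (LINT x|M. f x)"
  using integral_distr[OF translate_measurable_M assms, of s] by (simp add: distr_translate)

lemma integrable_translate:
  fixes f :: "'g \<Rightarrow> 'b::{banach, second_countable_topology}"
  assumes "integrable M f"
  shows "integrable M (\<lambda>x. f (s + x))"
  using integrable_distr_eq[OF translate_measurable_M borel_measurable_integrable[OF assms], of s] assms
  by (simp add: distr_translate)

lemma AE_translate:
  assumes "AE x in M. P x"
  shows "AE x in M. P (s + x)"
proof -
  have "AE x in distr M M ((+) s). P x" using assms unfolding distr_translate .
  then show ?thesis by (rule AE_distrD[OF translate_measurable_M])
qed

text \<open>The identity (delta_s * p) * f = delta_s * (p * f), by the substitution of
  \<open>s + y\<close> for \<open>y\<close>. It holds at every point, since invariance of the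
  integral asks only for measurability.\<close>

lemma conv_translate:
  assumes p: "p \<in> borel_measurable borel" and f: "f \<in> borel_measurable borel"
  shows "conv M (\<lambda>x. p (- s + x)) f x = conv M p f (- s + x)"
proof -
  have 1: "(\<lambda>y. p (- s + y)) \<in> borel_measurable borel" using p by measurable
  have m: "(\<lambda>y. p (- s + y) * f (- y + x)) \<in> borel_measurable M"
    by (rule conv_integrand_measurable[OF 1 f])
  have "conv M (\<lambda>x. p (- s + x)) f x = (LINT y|M. p (- s + (s + y)) * f (- (s + y) + x))"
    unfolding conv_def by (rule integral_translate[OF m, symmetric])
  also have "\<dots> = conv M p f (- s + x)"
    unfolding conv_def by (simp only: minus_add_cancel minus_add add.assoc)
  finally show ?thesis .
qed

end

subsection \<open>The weighted group algebra\<close>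

locale weighted_haar_group = haar_group M
  for M :: "'g::{topological_group_add,t2_space} measure" +
  fixes w :: "'g \<Rightarrow> real" and c :: real
  assumes weight: "is_weight w" and c_pos: "0 < c" and c_le: "c \<le> w x"
begin

lemma w_pos: "0 < w x" and w_mult: "w (s + t) \<le> w s * w t" and w_cont: "continuous_on UNIV w"
  using weight unfolding is_weight_def by auto

lemma w_nonneg[simp]: "0 \<le> w x"
  using w_pos[of x] by simp

lemma w_measurable[measurable]: "w \<in> borel_measurable borel"
  by (rule borel_measurable_continuous_onI[OF w_cont])

lemma L1w_measurable: "f \<in> L1w M w \<Longrightarrow> f \<in> borel_measurable borel"
  unfolding L1w_def by (simp add: borel_measurable_M)

lemma L1w_weighted_integrable: "f \<in> L1w M w \<Longrightarrow> integrable M (\<lambda>x. cmod (f x) * w x)"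
  unfolding L1w_def by simp

lemma cmod_le_weighted: "cmod z \<le> cmod z * w x / c"
proof -
  have "cmod z * c \<le> cmod z * w x" using c_le by (intro mult_left_mono) auto
  then show ?thesis using c_pos by (simp add: field_simps)
qed

lemma L1w_integrable:
  assumes "f \<in> L1w M w" shows "integrable M f"
proof (rule Bochner_Integration.integrable_bound)
  show "integrable M (\<lambda>x. cmod (f x) * w x / c)"
    using L1w_weighted_integrable[OF assms] by simp
  show "f \<in> borel_measurable M" using L1w_measurable[OF assms] by (simp add: borel_measurable_M)
  show "AE x in M. cmod (f x) \<le> norm (cmod (f x) * w x / c)"
    using cmod_le_weighted c_pos by (auto intro!: AE_I2 simp: abs_mult)
qed

lemma wnorm_nonneg: "0 \<le> wnorm M w f"
  unfolding wnorm_def by (intro integral_nonneg_AE AE_I2) simp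

lemma integral_cmod_le_wnorm:
  assumes "f \<in> L1w M w" shows "(LINT x|M. cmod (f x)) \<le> wnorm M w f / c"
proof -
  have "(LINT x|M. cmod (f x)) \<le> (LINT x|M. cmod (f x) * w x / c)"
    using L1w_integrable[OF assms] L1w_weighted_integrable[OF assms] cmod_le_weighted
    by (intro integral_mono) auto
  then show ?thesis by (simp add: wnorm_def)
qed

lemma norm_integral_le_wnorm:
  assumes "f \<in> L1w M w" shows "cmod (LINT x|M. f x) \<le> wnorm M w f / c"
  using integral_norm_bound[of M f] integral_cmod_le_wnorm[OF assms] by linarith

lemma nn_integral_L1w:
  assumes "f \<in> L1w M w"
  shows "(\<integral>\<^sup>+x. ennreal (cmod (f x) * w x) \<partial>M) = ennreal (wnorm M w f)"
  unfolding wnorm_def using L1w_weighted_integrable[OF assms] by (intro nn_integral_eq_integral) auto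

lemma L1wI:
  assumes "f \<in> borel_measurable borel" "(\<integral>\<^sup>+x. ennreal (cmod (f x) * w x) \<partial>M) \<le> ennreal B" "0 \<le> B"
  shows "f \<in> L1w M w" "wnorm M w f \<le> B"
proof -
  have m: "(\<lambda>x. cmod (f x) * w x) \<in> borel_measurable M"
    using assms(1) unfolding borel_measurable_M by measurable
  have "(\<integral>\<^sup>+x. ennreal (cmod (f x) * w x) \<partial>M) < \<infinity>"
    using assms(2) by (auto intro: le_less_trans)
  then show L: "f \<in> L1w M w"
    using m assms(1) unfolding L1w_def by (simp add: integrable_iff_bounded borel_measurable_M abs_mult)
  show "wnorm M w f \<le> B" using assms(2,3) unfolding nn_integral_L1w[OF L] by simp
qed

lemma L1w_lincomb:
  assumes "f \<in> L1w M w" "g \<in> L1w M w" shows "(\<lambda>x. f x + k * g x) \<in> L1w M w"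
proof -
  have m: "(\<lambda>x. f x + k * g x) \<in> borel_measurable M"
    using L1w_measurable[OF assms(1)] L1w_measurable[OF assms(2)] unfolding borel_measurable_M by measurable
  have "integrable M (\<lambda>x. cmod (f x + k * g x) * w x)"
  proof (rule Bochner_Integration.integrable_bound)
    show "integrable M (\<lambda>x. cmod (f x) * w x + cmod k * (cmod (g x) * w x))"
      using L1w_weighted_integrable[OF assms(1)] L1w_weighted_integrable[OF assms(2)] by simp
    show "(\<lambda>x. cmod (f x + k * g x) * w x) \<in> borel_measurable M"
      using m unfolding borel_measurable_M by measurable
    have "cmod (f x + k * g x) * w x \<le> (cmod (f x) + cmod (k * g x)) * w x" for x
      by (intro mult_right_mono norm_triangle_ineq) simp
    then show "AE x in M. norm (cmod (f x + k * g x) * w x) \<le> norm (cmod (f x) * w x + cmod k * (cmod (g x) * w x))"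
      by (intro AE_I2) (simp add: abs_mult norm_mult distrib_right mult.assoc)
  qed
  with m show ?thesis unfolding L1w_def by simp
qed

lemma L1w_scale:
  assumes "f \<in> L1w M w" shows "(\<lambda>x. k * f x) \<in> L1w M w" "wnorm M w (\<lambda>x. k * f x) = cmod k * wnorm M w f"
proof -
  have "(\<lambda>x. f x + (k - 1) * f x) \<in> L1w M w" by (rule L1w_lincomb[OF assms assms])
  then show "(\<lambda>x. k * f x) \<in> L1w M w" by (simp add: algebra_simps)
  show "wnorm M w (\<lambda>x. k * f x) = cmod k * wnorm M w f"
    unfolding wnorm_def by (simp add: norm_mult mult.assoc)
qed

text \<open>Since \<open>w x \<le> w y * w (- y + x)\<close>, the weighted convolution is dominated
  by the convolution of the weighted moduli, to which Tonelli's formula applies.\<close>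

lemma
  assumes f: "f \<in> L1w M w" and g: "g \<in> L1w M w"
  shows conv_L1w: "conv M f g \<in> L1w M w"
    and wnorm_conv_le: "wnorm M w (conv M f g) \<le> wnorm M w f * wnorm M w g"
proof -
  note fm = L1w_measurable[OF f] and gm = L1w_measurable[OF g]
  let ?f = "\<lambda>x. ennreal (cmod (f x) * w x)" and ?g = "\<lambda>x. ennreal (cmod (g x) * w x)"
  have pt: "ennreal (cmod (conv M f g x) * w x) \<le> (\<integral>\<^sup>+y. ?f y * ?g (- y + x) \<partial>M)" for x
  proof -
    have m: "(\<lambda>y. ennreal (cmod (f y)) * ennreal (cmod (g (- y + x)))) \<in> borel_measurable M"
      using fm gm unfolding borel_measurable_M by measurable
    have "ennreal (cmod (conv M f g x) * w x) = ennreal (w x) * ennreal (cmod (conv M f g x))"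
      by (simp add: ennreal_mult mult.commute)
    also have "\<dots> \<le> ennreal (w x) * (\<integral>\<^sup>+y. ennreal (cmod (f y)) * ennreal (cmod (g (- y + x))) \<partial>M)"
      by (intro mult_left_mono norm_conv_le fm gm) simp
    also have "\<dots> = (\<integral>\<^sup>+y. ennreal (w x) * (ennreal (cmod (f y)) * ennreal (cmod (g (- y + x)))) \<partial>M)"
      by (rule nn_integral_cmult[OF m, symmetric])
    also have "\<dots> \<le> (\<integral>\<^sup>+y. ?f y * ?g (- y + x) \<partial>M)"
    proof (rule nn_integral_mono)
      fix y
      have "w x \<le> w y * w (- y + x)" using w_mult[of y "- y + x"] by simp
      then have "w x * (cmod (f y) * cmod (g (- y + x))) \<le> w y * w (- y + x) * (cmod (f y) * cmod (g (- y + x)))"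
        by (intro mult_right_mono) auto
      also have "\<dots> = (cmod (f y) * w y) * (cmod (g (- y + x)) * w (- y + x))" by simp
      finally show "ennreal (w x) * (ennreal (cmod (f y)) * ennreal (cmod (g (- y + x)))) \<le> ?f y * ?g (- y + x)"
        by (simp add: ennreal_mult[symmetric] ennreal_leI)
    qed
    finally show ?thesis .
  qed
  have "(\<integral>\<^sup>+x. ennreal (cmod (conv M f g x) * w x) \<partial>M) \<le> (\<integral>\<^sup>+x. (\<integral>\<^sup>+y. ?f y * ?g (- y + x) \<partial>M) \<partial>M)"
    by (intro nn_integral_mono pt)
  also have "\<dots> = (\<integral>\<^sup>+x. ?f x \<partial>M) * (\<integral>\<^sup>+x. ?g x \<partial>M)"
    using fm gm by (intro nn_conv_integral) (auto simp: nn_integral_L1w[OF f] nn_integral_L1w[OF g])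
  also have "\<dots> = ennreal (wnorm M w f * wnorm M w g)"
    unfolding nn_integral_L1w[OF f] nn_integral_L1w[OF g] by (simp add: ennreal_mult wnorm_nonneg)
  finally have le: "(\<integral>\<^sup>+x. ennreal (cmod (conv M f g x) * w x) \<partial>M) \<le> ennreal (wnorm M w f * wnorm M w g)" .
  have cm: "conv M f g \<in> borel_measurable borel" by (rule conv_measurable[OF L1w_integrable[OF f] gm])
  show "conv M f g \<in> L1w M w" "wnorm M w (conv M f g) \<le> wnorm M w f * wnorm M w g"
    using L1wI[OF cm le] by (simp_all add: wnorm_nonneg)
qed

lemma L1w_translate:
  assumes "f \<in> L1w M w" shows "(\<lambda>x. f (- s + x)) \<in> L1w M w"
proof -
  have fm: "(\<lambda>x. f (- s + x)) \<in> borel_measurable borel" using L1w_measurable[OF assms] by measurable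
  have "integrable M (\<lambda>x. cmod (f (- s + x)) * w x)"
  proof (rule Bochner_Integration.integrable_bound)
    show "integrable M (\<lambda>x. w s * (cmod (f (- s + x)) * w (- s + x)))"
      using integrable_translate[OF L1w_weighted_integrable[OF assms], of "- s"] by simp
    show "(\<lambda>x. cmod (f (- s + x)) * w x) \<in> borel_measurable M"
      using fm unfolding borel_measurable_M by measurable
    have "cmod (f (- s + x)) * w x \<le> cmod (f (- s + x)) * (w s * w (- s + x))" for x
      using w_mult[of s "- s + x"] by (intro mult_left_mono) auto
    then show "AE x in M. norm (cmod (f (- s + x)) * w x) \<le> norm (w s * (cmod (f (- s + x)) * w (- s + x)))"
      by (intro AE_I2) (simp add: abs_mult mult.left_commute)
  qed
  with fm show ?thesis unfolding L1w_def by (simp add: borel_measurable_M)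
qed

text \<open>Tensors are given by series, so sums in L1(G,w) must be formed pointwise. Summable norms
  give absolute convergence almost everywhere; on the exceptional null set the value of the infinite
  sum is irrelevant.\<close>

lemma
  assumes f: "\<And>n. f n \<in> L1w M w" and s: "summable (\<lambda>n. wnorm M w (f n))"
  shows suminf_L1w: "(\<lambda>x. \<Sum>n. f n x) \<in> L1w M w"
    and suminf_integral_mult: "h \<in> borel_measurable borel \<Longrightarrow> (\<And>x. cmod (h x) \<le> 1) \<Longrightarrow>
      (\<lambda>n. LINT x|M. f n x * h x) sums (LINT x|M. (\<Sum>n. f n x) * h x)"
proof -
  have m: "(\<lambda>x. ennreal (cmod (f n x) * w x)) \<in> borel_measurable M" for n
    using L1w_measurable[OF f, of n] unfolding borel_measurable_M by measurable
  have "(\<integral>\<^sup>+x. (\<Sum>n. ennreal (cmod (f n x) * w x)) \<partial>M) = (\<Sum>n. ennreal (wnorm M w (f n)))"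
    by (subst nn_integral_suminf[OF m]) (simp add: nn_integral_L1w[OF f])
  also have "\<dots> \<noteq> \<infinity>" using s by (simp add: suminf_ennreal2 wnorm_nonneg)
  finally have "(\<integral>\<^sup>+x. (\<Sum>n. ennreal (cmod (f n x) * w x)) \<partial>M) \<noteq> \<infinity>" .
  then have "AE x in M. (\<Sum>n. ennreal (cmod (f n x) * w x)) \<noteq> \<infinity>"
    using m by (intro nn_integral_PInf_AE borel_measurable_suminf_order)
  then have ae: "AE x in M. summable (\<lambda>n. cmod (f n x))"
  proof eventually_elim
    case (elim x)
    then have "summable (\<lambda>n. cmod (f n x) * w x)" by (intro summable_suminf_not_top) auto
    then have "summable (\<lambda>n. cmod (f n x) * w x / w x)" by (rule summable_divide)
    then show ?case using w_pos[of x] by simp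
  qed
  \<comment> \<open>Used for two multipliers: \<open>k = w\<close> with \<open>C = 1\<close> shows
    that the sum lies in \<open>L1w M w\<close>, and \<open>k = h\<close> with
    \<open>C = 1 / c\<close> gives termwise integration.\<close>
  have int: "integrable M (\<lambda>x. \<Sum>n. f n x * k x)" "(\<lambda>n. LINT x|M. f n x * k x) sums (LINT x|M. (\<Sum>n. f n x * k x))"
    if k: "k \<in> borel_measurable borel" and kw: "\<And>x. cmod (k x) \<le> C * w x" for k C
  proof -
    have i: "integrable M (\<lambda>x. f n x * k x)" and le: "(LINT x|M. cmod (f n x * k x)) \<le> C * wnorm M w (f n)" for n
    proof -
      have b: "cmod (f n x * k x) \<le> C * (cmod (f n x) * w x)" for x
        using mult_left_mono[OF kw[of x], of "cmod (f n x)"] by (simp add: norm_mult mult.left_commute)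
      have bi: "integrable M (\<lambda>x. C * (cmod (f n x) * w x))" using L1w_weighted_integrable[OF f, of n] by simp
      show i: "integrable M (\<lambda>x. f n x * k x)"
      proof (rule Bochner_Integration.integrable_bound[OF bi])
        show "(\<lambda>x. f n x * k x) \<in> borel_measurable M"
          using k L1w_measurable[OF f, of n] unfolding borel_measurable_M by measurable
        show "AE x in M. cmod (f n x * k x) \<le> norm (C * (cmod (f n x) * w x))"
          using b by (intro AE_I2) (simp add: order_trans[OF _ abs_ge_self])
      qed
      have "(LINT x|M. cmod (f n x * k x)) \<le> (LINT x|M. C * (cmod (f n x) * w x))"
        using i bi b by (intro integral_mono) auto
      then show "(LINT x|M. cmod (f n x * k x)) \<le> C * wnorm M w (f n)" by (simp add: wnorm_def)
    qed
    have ae': "AE x in M. summable (\<lambda>n. norm (f n x * k x))"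
      using ae by eventually_elim (simp add: norm_mult summable_mult2)
    have s': "summable (\<lambda>n. LINT x|M. norm (f n x * k x))"
      by (rule summable_comparison_test'[OF summable_mult[OF s, of C], of 0]) (simp add: le)
    show "integrable M (\<lambda>x. \<Sum>n. f n x * k x)" "(\<lambda>n. LINT x|M. f n x * k x) sums (LINT x|M. (\<Sum>n. f n x * k x))"
      using integrable_suminf[OF i ae' s'] sums_integral[OF i ae' s'] by auto
  qed
  have pull: "AE x in M. (\<Sum>n. f n x * k x) = (\<Sum>n. f n x) * k x" for k
    using ae by eventually_elim (simp add: suminf_mult2[symmetric] summable_norm_cancel)
  have Fm: "(\<lambda>x. \<Sum>n. f n x) \<in> borel_measurable borel"
    using L1w_measurable[OF f] by measurable
  show "(\<lambda>x. \<Sum>n. f n x) \<in> L1w M w"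
  proof -
    have "integrable M (\<lambda>x. \<Sum>n. f n x * complex_of_real (w x))"
      by (rule int(1)[where C = 1]) auto
    then have "integrable M (\<lambda>x. (\<Sum>n. f n x) * complex_of_real (w x))"
    proof (rule integrable_cong_AE_imp)
      show "(\<lambda>x. (\<Sum>n. f n x) * complex_of_real (w x)) \<in> borel_measurable M"
        using Fm unfolding borel_measurable_M by measurable
      show "AE x in M. (\<Sum>n. f n x * complex_of_real (w x)) = (\<Sum>n. f n x) * complex_of_real (w x)"
        by (rule pull)
    qed
    from integrable_norm[OF this] show ?thesis
      using Fm unfolding L1w_def by (simp add: norm_mult borel_measurable_M)
  qed
  show "(\<lambda>n. LINT x|M. f n x * h x) sums (LINT x|M. (\<Sum>n. f n x) * h x)"
    if h: "h \<in> borel_measurable borel" "\<And>x. cmod (h x) \<le> 1"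
  proof -
    have hw: "cmod (h x) \<le> (1 / c) * w x" for x
      using order_trans[OF h(2), of "w x / c" x] c_le[of x] c_pos by (simp add: field_simps)
    have "(LINT x|M. (\<Sum>n. f n x * h x)) = (LINT x|M. (\<Sum>n. f n x) * h x)"
    proof (rule integral_cong_AE[OF _ _ pull])
      show "(\<lambda>x. \<Sum>n. f n x * h x) \<in> borel_measurable M"
        using int(1)[OF h(1) hw] by simp
      show "(\<lambda>x. (\<Sum>n. f n x) * h x) \<in> borel_measurable M"
        using Fm h(1) unfolding borel_measurable_M by measurable
    qed
    then show ?thesis using int(2)[OF h(1) hw] by simp
  qed
qed

text \<open>The normalised indicator of a compact neighbourhood of 0: it contains a nonempty open
  set, hence has positive measure, and compactness bounds both its measure and the weight on
  it.\<close>

lemma L1w_unit_integral: "\<exists>p\<in>L1w M w. (LINT x|M. p x) = 1"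
proof -
  obtain V K where VK: "open V" "compact K" "(0::'g) \<in> V" "V \<subseteq> K"
    using compact_neighbourhood[of UNIV 0] by auto
  have Kb: "K \<in> sets M" using VK by (simp add: borel_compact)
  have "0 < emeasure M V" using VK by (intro emeasure_open_pos) auto
  also have "\<dots> \<le> emeasure M K" using VK Kb by (intro emeasure_mono) auto
  finally have pos: "0 < emeasure M K" .
  have fin: "emeasure M K < \<infinity>" by (rule emeasure_compact[OF VK(2)])
  define r where "r = measure M K"
  have r: "0 < r" using pos fin unfolding r_def measure_def by (simp add: enn2real_positive_iff)
  have "compact (w ` K)" by (intro compact_continuous_image continuous_on_subset[OF w_cont] VK) simp
  then obtain C where C: "\<And>x. x \<in> K \<Longrightarrow> w x \<le> C"
    by (metis bounded_real compact_imp_bounded image_eqI abs_le_D1)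
  let ?p = "\<lambda>x. complex_of_real (indicator K x / r)"
  have ind: "integrable M (indicator K :: _ \<Rightarrow> real)" using Kb fin by (intro integrable_real_indicator) auto
  have pm: "?p \<in> borel_measurable M" using Kb by measurable
  have "integrable M (\<lambda>x. cmod (?p x) * w x)"
  proof (rule Bochner_Integration.integrable_bound)
    show "integrable M (\<lambda>x. C / r * indicator K x)" using ind by simp
    show "(\<lambda>x. cmod (?p x) * w x) \<in> borel_measurable M"
      using pm unfolding borel_measurable_M by measurable
    show "AE x in M. norm (cmod (?p x) * w x) \<le> norm (C / r * indicator K x)"
    proof (rule AE_I2)
      fix x show "norm (cmod (?p x) * w x) \<le> norm (C / r * indicator K x)"
        using C[of x] r w_pos[of x] by (auto simp: indicator_def norm_divide abs_mult field_simps)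
    qed
  qed
  then have "?p \<in> L1w M w" using pm unfolding L1w_def by simp
  moreover have "(LINT x|M. ?p x) = 1"
  proof -
    have "(LINT x|M. ?p x) = of_real (LINT x|M. indicator K x / r)" by (rule integral_complex_of_real)
    also have "(LINT x|M. indicator K x / r) = 1" using Kb fin r by (simp add: r_def)
    finally show ?thesis by simp
  qed
  ultimately show ?thesis by blast
qed

subsection \<open>Almost invariant functions from an approximate diagonal\<close>

lemma tensor_rep_lmod:
  assumes "tensor_rep M w u" "p \<in> L1w M w" shows "tensor_rep M w (lmod M p u)"
proof -
  have u: "fst (u n) \<in> L1w M w" "snd (u n) \<in> L1w M w" for n using assms unfolding tensor_rep_def by auto
  have "summable (\<lambda>n. wnorm M w (conv M p (fst (u n))) * wnorm M w (snd (u n)))"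
  proof (rule summable_comparison_test'[of "\<lambda>n. wnorm M w p * (wnorm M w (fst (u n)) * wnorm M w (snd (u n)))" 0])
    show "summable (\<lambda>n. wnorm M w p * (wnorm M w (fst (u n)) * wnorm M w (snd (u n))))"
      using assms(1) unfolding tensor_rep_def by (intro summable_mult) auto
    show "norm (wnorm M w (conv M p (fst (u n))) * wnorm M w (snd (u n)))
      \<le> wnorm M w p * (wnorm M w (fst (u n)) * wnorm M w (snd (u n)))" for n
      using mult_right_mono[OF wnorm_conv_le[OF assms(2) u(1)[of n]] wnorm_nonneg[of "snd (u n)"]]
      by (simp add: wnorm_nonneg mult.assoc)
  qed
  then show ?thesis using u assms(2) unfolding tensor_rep_def lmod_def by (auto intro: conv_L1w)
qed

lemma tensor_rep_rmod:
  assumes "tensor_rep M w u" "p \<in> L1w M w" shows "tensor_rep M w (rmod M u p)"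
proof -
  have u: "fst (u n) \<in> L1w M w" "snd (u n) \<in> L1w M w" for n using assms unfolding tensor_rep_def by auto
  have "summable (\<lambda>n. wnorm M w (fst (u n)) * wnorm M w (conv M (snd (u n)) p))"
  proof (rule summable_comparison_test'[of "\<lambda>n. wnorm M w (fst (u n)) * wnorm M w (snd (u n)) * wnorm M w p" 0])
    show "summable (\<lambda>n. wnorm M w (fst (u n)) * wnorm M w (snd (u n)) * wnorm M w p)"
      using assms(1) unfolding tensor_rep_def by (intro summable_mult2) auto
    show "norm (wnorm M w (fst (u n)) * wnorm M w (conv M (snd (u n)) p))
      \<le> wnorm M w (fst (u n)) * wnorm M w (snd (u n)) * wnorm M w p" for n
      using mult_left_mono[OF wnorm_conv_le[OF u(2)[of n] assms(2)] wnorm_nonneg[of "fst (u n)"]]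
      by (simp add: wnorm_nonneg mult.assoc)
  qed
  then show ?thesis using u assms(2) unfolding tensor_rep_def rmod_def by (auto intro: conv_L1w)
qed

lemma tpair_bound:
  assumes u: "tensor_rep M w u" and B: "B \<in> bil_unit M w"
  shows "cmod (tpair B u) \<le> (\<Sum>n. wnorm M w (fst (u n)) * wnorm M w (snd (u n)))"
proof -
  have le: "cmod (B (fst (u n)) (snd (u n))) \<le> wnorm M w (fst (u n)) * wnorm M w (snd (u n))" for n
    using u B unfolding tensor_rep_def bil_unit_def by auto
  have s: "summable (\<lambda>n. wnorm M w (fst (u n)) * wnorm M w (snd (u n)))"
    using u unfolding tensor_rep_def by auto
  have s1: "summable (\<lambda>n. cmod (B (fst (u n)) (snd (u n))))"
    by (rule summable_comparison_test'[OF s, of 0]) (simp add: le)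
  show ?thesis unfolding tpair_def
    using summable_norm[OF s1] suminf_le[OF le s1 s] by linarith
qed

text \<open>The supremum is taken in the reals, so boundedness has to be checked; the sums of the
  products of norms in the two representations bound it.\<close>

lemma tdist_ge:
  assumes u: "tensor_rep M w u" and v: "tensor_rep M w v" and B: "B \<in> bil_unit M w"
  shows "cmod (tpair B u - tpair B v) \<le> tdist M w u v"
  unfolding tdist_def
proof (rule cSup_upper)
  show "cmod (tpair B u - tpair B v) \<in> (\<lambda>B. cmod (tpair B u - tpair B v)) ` bil_unit M w" using B by blast
  show "bdd_above ((\<lambda>B. cmod (tpair B u - tpair B v)) ` bil_unit M w)"
  proof (rule bdd_aboveI2)
    fix B assume B: "B \<in> bil_unit M w"
    show "cmod (tpair B u - tpair B v) \<le> (\<Sum>n. wnorm M w (fst (u n)) * wnorm M w (snd (u n)))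
        + (\<Sum>n. wnorm M w (fst (v n)) * wnorm M w (snd (v n)))"
      using norm_triangle_ineq4[of "tpair B u" "tpair B v"] tpair_bound[OF u B] tpair_bound[OF v B] by linarith
  qed
qed

text \<open>The image of \<open>u\<close> under \<open>id \<otimes> \<integral>\<close>.\<close>

definition aug :: "(nat \<Rightarrow> ('g \<Rightarrow> complex) \<times> ('g \<Rightarrow> complex)) \<Rightarrow> 'g \<Rightarrow> complex" where
  "aug u x = (\<Sum>n. (LINT y|M. snd (u n) y) * fst (u n) x)"

text \<open>The norm of term \<open>n\<close> is at most
  \<open>wnorm M w (fst (u n)) * wnorm M w (snd (u n)) / c\<close>, so the series converges in
  L1(G,w). The second fact says that pairing \<open>aug u\<close> with \<open>h\<close> evaluates a
  rank-one form on \<open>u\<close>, which links \<open>aug\<close> to \<open>tpair\<close>.\<close>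

lemma
  assumes u: "tensor_rep M w u"
  shows aug_L1w: "aug u \<in> L1w M w"
    and aug_integral_mult: "h \<in> borel_measurable borel \<Longrightarrow> (\<And>x. cmod (h x) \<le> 1) \<Longrightarrow>
      (\<lambda>n. (LINT x|M. snd (u n) x) * (LINT x|M. fst (u n) x * h x)) sums (LINT x|M. aug u x * h x)"
proof -
  have L: "fst (u n) \<in> L1w M w" "snd (u n) \<in> L1w M w" for n using u unfolding tensor_rep_def by auto
  let ?f = "\<lambda>n x. (LINT y|M. snd (u n) y) * fst (u n) x"
  have f: "?f n \<in> L1w M w" for n by (rule L1w_scale(1)[OF L(1)])
  have s: "summable (\<lambda>n. wnorm M w (?f n))"
  proof (rule summable_comparison_test'[of "\<lambda>n. wnorm M w (fst (u n)) * wnorm M w (snd (u n)) / c" 0])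
    show "summable (\<lambda>n. wnorm M w (fst (u n)) * wnorm M w (snd (u n)) / c)"
      using u unfolding tensor_rep_def by (intro summable_divide) auto
    show "norm (wnorm M w (?f n)) \<le> wnorm M w (fst (u n)) * wnorm M w (snd (u n)) / c" for n
      using mult_right_mono[OF norm_integral_le_wnorm[OF L(2)[of n]] wnorm_nonneg[of "fst (u n)"]]
      unfolding L1w_scale(2)[OF L(1)] by (simp add: wnorm_nonneg mult.commute)
  qed
  show "aug u \<in> L1w M w" unfolding aug_def[abs_def] by (rule suminf_L1w[OF f s])
  show "(\<lambda>n. (LINT x|M. snd (u n) x) * (LINT x|M. fst (u n) x * h x)) sums (LINT x|M. aug u x * h x)"
    if "h \<in> borel_measurable borel" "\<And>x. cmod (h x) \<le> 1"
    using suminf_integral_mult[OF f s that] by (simp add: aug_def mult.assoc)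
qed

text \<open>Each of the two functionals has norm at most \<open>1 / c\<close> because the weight is
  at least \<open>c\<close>; the factor \<open>c^2\<close> brings the form into the unit
  ball.\<close>

lemma rank_one_bil_unit:
  assumes h: "h \<in> borel_measurable borel" "\<And>x. cmod (h x) \<le> 1"
  shows "(\<lambda>f g. of_real (c\<^sup>2) * (LINT x|M. f x * h x) * (LINT x|M. g x)) \<in> bil_unit M w"
proof -
  have hi: "integrable M (\<lambda>x. f x * h x)" if "f \<in> L1w M w" for f
  proof (rule Bochner_Integration.integrable_bound[OF L1w_integrable[OF that]])
    show "(\<lambda>x. f x * h x) \<in> borel_measurable M"
      using L1w_measurable[OF that] h(1) unfolding borel_measurable_M by measurable
    show "AE x in M. cmod (f x * h x) \<le> cmod (f x)"
      using h(2) by (auto simp: norm_mult mult_left_le)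
  qed
  have hb: "cmod (LINT x|M. f x * h x) \<le> wnorm M w f / c" if "f \<in> L1w M w" for f
  proof -
    have "cmod (LINT x|M. f x * h x) \<le> (LINT x|M. cmod (f x * h x))" by (rule integral_norm_bound)
    also have "\<dots> \<le> (LINT x|M. cmod (f x))"
      using hi[OF that] L1w_integrable[OF that] h(2) by (intro integral_mono integrable_norm) (auto simp: norm_mult mult_left_le)
    also have "\<dots> \<le> wnorm M w f / c" by (rule integral_cmod_le_wnorm[OF that])
    finally show ?thesis .
  qed
  have lin1: "(LINT x|M. (f1 x + k * f2 x) * h x) = (LINT x|M. f1 x * h x) + k * (LINT x|M. f2 x * h x)"
    if "f1 \<in> L1w M w" "f2 \<in> L1w M w" for f1 f2 k
  proof -
    have "(LINT x|M. (f1 x + k * f2 x) * h x) = (LINT x|M. f1 x * h x + k * (f2 x * h x))"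
      by (simp add: distrib_right mult.assoc)
    also have "\<dots> = (LINT x|M. f1 x * h x) + (LINT x|M. k * (f2 x * h x))"
      using hi[OF that(1)] hi[OF that(2)] by (intro Bochner_Integration.integral_add) auto
    finally show ?thesis by simp
  qed
  have lin2: "(LINT x|M. f1 x + k * f2 x) = (LINT x|M. f1 x) + k * (LINT x|M. f2 x)"
    if "f1 \<in> L1w M w" "f2 \<in> L1w M w" for f1 f2 k
    using L1w_integrable[OF that(1)] L1w_integrable[OF that(2)] by simp
  have bd: "cmod (of_real (c\<^sup>2) * (LINT x|M. f x * h x) * (LINT x|M. g x)) \<le> wnorm M w f * wnorm M w g"
    if "f \<in> L1w M w" "g \<in> L1w M w" for f g
  proof -
    have "cmod (LINT x|M. f x * h x) * cmod (LINT x|M. g x) \<le> (wnorm M w f / c) * (wnorm M w g / c)"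
      using c_pos wnorm_nonneg by (intro mult_mono hb norm_integral_le_wnorm that) auto
    then have "c\<^sup>2 * (cmod (LINT x|M. f x * h x) * cmod (LINT x|M. g x)) \<le> c\<^sup>2 * ((wnorm M w f / c) * (wnorm M w g / c))"
      by (rule mult_left_mono) simp
    also have "\<dots> = wnorm M w f * wnorm M w g" using c_pos by (simp add: power2_eq_square)
    finally show ?thesis by (simp add: norm_mult norm_power mult.assoc)
  qed
  show ?thesis unfolding bil_unit_def
  proof (intro CollectI conjI ballI allI bd)
    fix f1 f2 g k assume L: "f1 \<in> L1w M w" "f2 \<in> L1w M w" "g \<in> L1w M w"
    show "of_real (c\<^sup>2) * (LINT x|M. (f1 x + k * f2 x) * h x) * (LINT x|M. g x)
      = of_real (c\<^sup>2) * (LINT x|M. f1 x * h x) * (LINT x|M. g x)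
        + k * (of_real (c\<^sup>2) * (LINT x|M. f2 x * h x) * (LINT x|M. g x))"
      unfolding lin1[OF L(1,2)] by (simp add: algebra_simps)
    show "of_real (c\<^sup>2) * (LINT x|M. g x * h x) * (LINT x|M. f1 x + k * f2 x)
      = of_real (c\<^sup>2) * (LINT x|M. g x * h x) * (LINT x|M. f1 x)
        + k * (of_real (c\<^sup>2) * (LINT x|M. g x * h x) * (LINT x|M. f2 x))"
      unfolding lin2[OF L(1,2)] by (simp add: algebra_simps)
  qed
qed

text \<open>Duality between L1 and bounded functions: since \<open>p\<close> has integral 1, the
  rank-one form for \<open>h\<close> takes on \<open>lmod M p u\<close> minus
  \<open>rmod M u p\<close> the value \<open>c^2\<close> times the pairing of
  \<open>aug (lmod M p u) - aug u\<close> with \<open>h\<close>. A suitable \<open>h\<close> makes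
  this pairing the L1 norm.\<close>

lemma aug_lmod_dist:
  assumes u: "tensor_rep M w u" and p: "p \<in> L1w M w" "(LINT x|M. p x) = 1"
  shows "(LINT x|M. cmod (aug (lmod M p u) x - aug u x)) \<le> tdist M w (lmod M p u) (rmod M u p) / c\<^sup>2"
proof -
  note lu = tensor_rep_lmod[OF u p(1)] and ru = tensor_rep_rmod[OF u p(1)]
  have L: "fst (u n) \<in> L1w M w" "snd (u n) \<in> L1w M w" for n using u unfolding tensor_rep_def by auto
  \<comment> \<open>The inverse phase of the difference, so that the difference times
    \<open>h\<close> is its modulus; where the difference is 0, division yields
    \<open>h x = 0\<close>.\<close>
  define h where "h x = of_real (cmod (aug (lmod M p u) x - aug u x)) / (aug (lmod M p u) x - aug u x)" for x
  have [measurable]: "aug (lmod M p u) \<in> borel_measurable borel" "aug u \<in> borel_measurable borel"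
    by (rule L1w_measurable[OF aug_L1w[OF lu]], rule L1w_measurable[OF aug_L1w[OF u]])
  have "h \<in> borel_measurable borel" unfolding h_def by measurable
  moreover have "cmod (h x) \<le> 1" for x by (simp add: h_def norm_divide)
  ultimately have h: "h \<in> borel_measurable borel" "\<And>x. cmod (h x) \<le> 1" by auto
  let ?B = "\<lambda>f g. of_real (c\<^sup>2) * (LINT x|M. f x * h x) * (LINT x|M. g x)"
  have "(\<lambda>n. of_real (c\<^sup>2) * ((LINT x|M. snd (lmod M p u n) x) * (LINT x|M. fst (lmod M p u n) x * h x)))
      sums (of_real (c\<^sup>2) * (LINT x|M. aug (lmod M p u) x * h x))"
    by (intro sums_mult aug_integral_mult[OF lu] h)
  then have 1: "tpair ?B (lmod M p u) = of_real (c\<^sup>2) * (LINT x|M. aug (lmod M p u) x * h x)"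
    unfolding tpair_def by (simp add: sums_iff mult.commute mult.left_commute)
  \<comment> \<open>The right action disappears: convolving with \<open>p\<close> on the right
    multiplies the integral by that of \<open>p\<close>, which is 1.\<close>
  have "(LINT x|M. snd (rmod M u p n) x) = (LINT x|M. snd (u n) x)" for n
    unfolding rmod_def using integral_conv[OF L1w_integrable[OF L(2)] L1w_integrable[OF p(1)], of n] p(2) by simp
  moreover have "(\<lambda>n. of_real (c\<^sup>2) * ((LINT x|M. snd (u n) x) * (LINT x|M. fst (u n) x * h x)))
      sums (of_real (c\<^sup>2) * (LINT x|M. aug u x * h x))"
    by (intro sums_mult aug_integral_mult[OF u] h)
  ultimately have 2: "tpair ?B (rmod M u p) = of_real (c\<^sup>2) * (LINT x|M. aug u x * h x)"
    unfolding tpair_def by (simp add: sums_iff mult.commute mult.left_commute rmod_def)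
  have hi: "integrable M (\<lambda>x. f x * h x)" if "f \<in> L1w M w" for f
  proof (rule Bochner_Integration.integrable_bound[OF L1w_integrable[OF that]])
    show "(\<lambda>x. f x * h x) \<in> borel_measurable M"
      using L1w_measurable[OF that] h(1) unfolding borel_measurable_M by measurable
    show "AE x in M. cmod (f x * h x) \<le> cmod (f x)"
      using h(2) by (auto simp: norm_mult mult_left_le)
  qed
  have z: "z * (of_real (cmod z) / z) = complex_of_real (cmod z)" for z by (cases "z = 0") auto
  have "tpair ?B (lmod M p u) - tpair ?B (rmod M u p)
      = of_real (c\<^sup>2) * (LINT x|M. aug (lmod M p u) x * h x - aug u x * h x)"
    unfolding 1 2 using hi[OF aug_L1w[OF lu]] hi[OF aug_L1w[OF u]] by (simp add: right_diff_distrib)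
  also have "(LINT x|M. aug (lmod M p u) x * h x - aug u x * h x) = (LINT x|M. of_real (cmod (aug (lmod M p u) x - aug u x)))"
    by (intro Bochner_Integration.integral_cong refl) (simp only: left_diff_distrib[symmetric] h_def z)
  also have "\<dots> = of_real (LINT x|M. cmod (aug (lmod M p u) x - aug u x))" by (rule integral_complex_of_real)
  finally have "cmod (tpair ?B (lmod M p u) - tpair ?B (rmod M u p)) = c\<^sup>2 * (LINT x|M. cmod (aug (lmod M p u) x - aug u x))"
    by (simp add: norm_mult norm_power)
  with tdist_ge[OF lu ru rank_one_bil_unit[OF h]] c_pos show ?thesis
    by (simp add: field_simps)
qed

text \<open>Both integrals equal the sum over \<open>n\<close> of the integral of
  \<open>fst (u n)\<close> times that of \<open>snd (u n)\<close>, by multiplicativity.\<close>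

lemma tpi_L1w:
  assumes u: "tensor_rep M w u"
  shows "tpi M u \<in> L1w M w" and "(LINT x|M. tpi M u x) = (LINT x|M. aug u x)"
proof -
  have L: "fst (u n) \<in> L1w M w" "snd (u n) \<in> L1w M w" for n using u unfolding tensor_rep_def by auto
  let ?f = "\<lambda>n. conv M (fst (u n)) (snd (u n))"
  have f: "?f n \<in> L1w M w" for n by (rule conv_L1w[OF L])
  have s: "summable (\<lambda>n. wnorm M w (?f n))"
  proof (rule summable_comparison_test'[of "\<lambda>n. wnorm M w (fst (u n)) * wnorm M w (snd (u n))" 0])
    show "summable (\<lambda>n. wnorm M w (fst (u n)) * wnorm M w (snd (u n)))" using u unfolding tensor_rep_def by auto
    show "norm (wnorm M w (?f n)) \<le> wnorm M w (fst (u n)) * wnorm M w (snd (u n))" for n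
      using wnorm_conv_le[OF L] by (simp add: wnorm_nonneg)
  qed
  show "tpi M u \<in> L1w M w" unfolding tpi_def[abs_def] by (rule suminf_L1w[OF f s])
  have "(\<lambda>n. LINT x|M. ?f n x) sums (LINT x|M. tpi M u x)"
    using suminf_integral_mult[OF f s, of "\<lambda>x. 1"] by (simp add: tpi_def)
  moreover have "(\<lambda>n. LINT x|M. ?f n x) sums (LINT x|M. aug u x)"
    using aug_integral_mult[OF u, of "\<lambda>x. 1"]
    by (simp add: integral_conv L1w_integrable L mult.commute)
  ultimately show "(LINT x|M. tpi M u x) = (LINT x|M. aug u x)" by (rule sums_unique2)
qed

text \<open>Integrating \<open>p * tpi M u - p\<close> gives the integral of \<open>aug u\<close>
  minus 1, because \<open>p\<close> has integral 1.\<close>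

lemma aug_integral_dist:
  assumes u: "tensor_rep M w u" and p: "p \<in> L1w M w" "(LINT x|M. p x) = 1"
  shows "cmod ((LINT x|M. aug u x) - 1) \<le> wnorm M w (\<lambda>x. conv M p (tpi M u) x - p x) / c"
proof -
  note t = tpi_L1w[OF u]
  have L: "(\<lambda>x. conv M p (tpi M u) x - p x) \<in> L1w M w"
    using L1w_lincomb[OF conv_L1w[OF p(1) t(1)] p(1), of "-1"] by simp
  have "(LINT x|M. conv M p (tpi M u) x - p x) = (LINT x|M. aug u x) - 1"
    using integral_conv[OF L1w_integrable[OF p(1)] L1w_integrable[OF t(1)]] p t(2)
      L1w_integrable[OF p(1)] L1w_integrable[OF conv_L1w[OF p(1) t(1)]] by simp
  with norm_integral_le_wnorm[OF L] show ?thesis by simp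
qed

text \<open>With phi = \<open>aug u\<close>, the intermediate function is delta_s * (p * phi). Its
  distance to delta_s * phi equals that of p * phi to phi by invariance, and being (delta_s * p) *
  phi it is close to phi by the same estimate for the translate of \<open>p\<close>.\<close>

lemma aug_translate_dist:
  assumes u: "tensor_rep M w u" and p: "p \<in> L1w M w" "(LINT x|M. p x) = 1"
  shows "(LINT x|M. cmod (aug u (- s + x) - aug u x)) \<le> tdist M w (lmod M p u) (rmod M u p) / c\<^sup>2
    + tdist M w (lmod M (\<lambda>x. p (- s + x)) u) (rmod M u (\<lambda>x. p (- s + x))) / c\<^sup>2"
proof -
  let ?q = "\<lambda>x. p (- s + x)"
  have L: "fst (u n) \<in> L1w M w" "snd (u n) \<in> L1w M w" for n using u unfolding tensor_rep_def by auto
  have q: "?q \<in> L1w M w" by (rule L1w_translate[OF p(1)])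
  have q1: "(LINT x|M. ?q x) = 1"
    using integral_translate[of p "- s"] L1w_measurable[OF p(1)] p(2) by (simp add: borel_measurable_M)
  have tr: "aug (lmod M ?q u) x = aug (lmod M p u) (- s + x)" for x
    unfolding aug_def lmod_def using conv_translate[OF L1w_measurable[OF p(1)] L1w_measurable[OF L(1)]] by simp
  let ?a = "aug u" and ?b = "aug (lmod M p u)"
  have a: "integrable M ?a" by (rule L1w_integrable[OF aug_L1w[OF u]])
  have b: "integrable M ?b" by (rule L1w_integrable[OF aug_L1w[OF tensor_rep_lmod[OF u p(1)]]])
  have a': "integrable M (\<lambda>x. ?a (- s + x))" and b': "integrable M (\<lambda>x. ?b (- s + x))"
    by (rule integrable_translate[OF a], rule integrable_translate[OF b])
  have "(LINT x|M. cmod (?a (- s + x) - ?a x)) \<le> (LINT x|M. cmod (?b (- s + x) - ?a (- s + x)) + cmod (?b (- s + x) - ?a x))"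
  proof (rule integral_mono)
    fix x
    show "cmod (?a (- s + x) - ?a x) \<le> cmod (?b (- s + x) - ?a (- s + x)) + cmod (?b (- s + x) - ?a x)"
      using norm_triangle_ineq[of "?a (- s + x) - ?b (- s + x)" "?b (- s + x) - ?a x"] by (simp add: norm_minus_commute)
  qed (use a a' b b' in auto)
  also have "\<dots> = (LINT x|M. cmod (?b (- s + x) - ?a (- s + x))) + (LINT x|M. cmod (?b (- s + x) - ?a x))"
    using a a' b b' by (intro Bochner_Integration.integral_add) auto
  also have "(LINT x|M. cmod (?b (- s + x) - ?a (- s + x))) = (LINT x|M. cmod (?b x - ?a x))"
    using integral_translate[of "\<lambda>x. cmod (?b x - ?a x)" "- s"] a b by auto
  finally show ?thesis using aug_lmod_dist[OF u p] aug_lmod_dist[OF u q q1] unfolding tr by linarith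
qed

lemma approx_diagonal_imp_almost_invariant:
  assumes "approx_diagonal M w F m"
  shows "\<exists>\<phi>. (\<forall>i. integrable M (\<phi> i)) \<and> ((\<lambda>i. LINT x|M. \<phi> i x) \<longlongrightarrow> (1::complex)) F \<and>
    (\<forall>s. ((\<lambda>i. LINT x|M. cmod (\<phi> i (- s + x) - \<phi> i x)) \<longlongrightarrow> 0) F)"
proof -
  have u: "tensor_rep M w (m i)" for i using assms unfolding approx_diagonal_def by auto
  have t: "((\<lambda>i. tdist M w (lmod M a (m i)) (rmod M (m i) a)) \<longlongrightarrow> 0) F"
    "((\<lambda>i. wnorm M w (\<lambda>x. conv M a (tpi M (m i)) x - a x)) \<longlongrightarrow> 0) F" if "a \<in> L1w M w" for a
    using assms that unfolding approx_diagonal_def by auto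
  obtain p where p: "p \<in> L1w M w" "(LINT x|M. p x) = 1" using L1w_unit_integral by blast
  have "((\<lambda>i. LINT x|M. aug (m i) x) \<longlongrightarrow> 1) F"
  proof (rule Lim_null[THEN iffD2], rule Lim_null_comparison)
    show "\<forall>\<^sub>F i in F. norm ((LINT x|M. aug (m i) x) - 1) \<le> wnorm M w (\<lambda>x. conv M p (tpi M (m i)) x - p x) / c"
      by (intro always_eventually allI aug_integral_dist u p)
    show "((\<lambda>i. wnorm M w (\<lambda>x. conv M p (tpi M (m i)) x - p x) / c) \<longlongrightarrow> 0) F"
      using tendsto_divide[OF t(2)[OF p(1)] tendsto_const, of c] c_pos by simp
  qed
  moreover have "((\<lambda>i. LINT x|M. cmod (aug (m i) (- s + x) - aug (m i) x)) \<longlongrightarrow> 0) F" for s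
  proof (rule Lim_null_comparison)
    let ?q = "\<lambda>x. p (- s + x)"
    show "\<forall>\<^sub>F i in F. norm (LINT x|M. cmod (aug (m i) (- s + x) - aug (m i) x))
      \<le> tdist M w (lmod M p (m i)) (rmod M (m i) p) / c\<^sup>2 + tdist M w (lmod M ?q (m i)) (rmod M (m i) ?q) / c\<^sup>2"
      using aug_translate_dist[OF u p] by (auto intro!: always_eventually simp: integral_nonneg_AE)
    show "((\<lambda>i. tdist M w (lmod M p (m i)) (rmod M (m i) p) / c\<^sup>2 + tdist M w (lmod M ?q (m i)) (rmod M (m i) ?q) / c\<^sup>2) \<longlongrightarrow> 0) F"
      using tendsto_add[OF tendsto_divide[OF t(1)[OF p(1)] tendsto_const, of "c\<^sup>2"]
          tendsto_divide[OF t(1)[OF L1w_translate[OF p(1)]] tendsto_const, of "c\<^sup>2" s]] c_pos by simp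
  qed
  ultimately show ?thesis using L1w_integrable[OF aug_L1w[OF u]]
    by (intro exI[of _ "\<lambda>i. aug (m i)"]) blast
qed

end

subsection \<open>An invariant mean from almost invariant functions\<close>

text \<open>Tychonoff's theorem for a product of intervals. It plays the role of weak* compactness,
  with functionals regarded merely as functions and linearity recovered in the limit.\<close>

lemma compact_bounded_functions: "compact {\<mu> :: 'a \<Rightarrow> real. \<forall>f. \<bar>\<mu> f\<bar> \<le> C f}"
proof -
  have "compactin (product_topology (\<lambda>_. euclidean) UNIV) (PiE UNIV (\<lambda>f. {- C f .. C f}))"
    unfolding compactin_PiE by auto
  moreover have "PiE UNIV (\<lambda>f. {- C f .. C f}) = {\<mu>. \<forall>f. \<bar>\<mu> f\<bar> \<le> C f}"
    by (auto simp: PiE_def Pi_def abs_le_iff minus_le_iff)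
  ultimately show ?thesis by (simp add: euclidean_product_topology)
qed

context haar_group
begin

lemma Linf_measurable: "f \<in> Linf M \<Longrightarrow> f \<in> borel_measurable M"
  unfolding Linf_def by auto

lemma Linf_lincomb:
  assumes "f \<in> Linf M" "g \<in> Linf M" shows "(\<lambda>x. f x + k * g x) \<in> Linf M"
proof -
  from assms obtain A B where A: "AE x in M. \<bar>f x\<bar> \<le> A" and B: "AE x in M. \<bar>g x\<bar> \<le> B"
    unfolding Linf_def by auto
  from A B have "AE x in M. \<bar>f x + k * g x\<bar> \<le> A + \<bar>k\<bar> * B"
  proof eventually_elim
    case (elim x)
    then have "\<bar>k * g x\<bar> \<le> \<bar>k\<bar> * B" by (simp add: abs_mult mult_left_mono)
    with elim show ?case by linarith
  qed
  then show ?thesis using assms unfolding Linf_def by auto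
qed

lemma Linf_translate:
  assumes "f \<in> Linf M" shows "(\<lambda>x. f (s + x)) \<in> Linf M"
proof -
  from assms obtain A where A: "AE x in M. \<bar>f x\<bar> \<le> A" unfolding Linf_def by auto
  have "f \<in> borel_measurable borel" using assms unfolding Linf_def by (simp add: borel_measurable_M)
  then have "(\<lambda>x. f (s + x)) \<in> borel_measurable M" unfolding borel_measurable_M by measurable
  with AE_translate[OF A, of s] show ?thesis unfolding Linf_def by auto
qed

lemma integrable_Linf_mult:
  fixes \<psi> :: "'g \<Rightarrow> real"
  assumes f: "f \<in> borel_measurable M" "AE x in M. \<bar>f x\<bar> \<le> C" and \<psi>: "integrable M \<psi>"
  shows "integrable M (\<lambda>x. f x * \<psi> x)" and "\<bar>LINT x|M. f x * \<psi> x\<bar> \<le> C * (LINT x|M. \<bar>\<psi> x\<bar>)"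
proof -
  have ae: "AE x in M. \<bar>f x * \<psi> x\<bar> \<le> C * \<bar>\<psi> x\<bar>"
    using f(2) by eventually_elim (simp add: abs_mult mult_right_mono)
  show i: "integrable M (\<lambda>x. f x * \<psi> x)"
  proof (rule Bochner_Integration.integrable_bound)
    show "integrable M (\<lambda>x. C * \<bar>\<psi> x\<bar>)" using \<psi> by simp
    show "(\<lambda>x. f x * \<psi> x) \<in> borel_measurable M" using f(1) \<psi> by simp
    show "AE x in M. norm (f x * \<psi> x) \<le> norm (C * \<bar>\<psi> x\<bar>)"
      using ae by eventually_elim (simp add: order_trans[OF _ abs_ge_self])
  qed
  have "\<bar>LINT x|M. f x * \<psi> x\<bar> \<le> (LINT x|M. \<bar>f x * \<psi> x\<bar>)" by (rule integral_abs_bound)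
  also have "\<dots> \<le> (LINT x|M. C * \<bar>\<psi> x\<bar>)"
    using i \<psi> by (intro integral_mono_AE[OF _ _ ae]) auto
  finally show "\<bar>LINT x|M. f x * \<psi> x\<bar> \<le> C * (LINT x|M. \<bar>\<psi> x\<bar>)" by simp
qed

text \<open>The means are integration against |phi_i| / norm(phi_i). Linearity, positivity, total
  mass and invariance hold for them exactly or asymptotically, and each passes to a cluster point
  because it involves only finitely many coordinates.\<close>

lemma almost_invariant_imp_amenable:
  fixes \<phi> :: "'i \<Rightarrow> 'g \<Rightarrow> complex"
  assumes F: "F \<noteq> bot" and \<phi>: "\<And>i. integrable M (\<phi> i)"
    and mass: "((\<lambda>i. LINT x|M. \<phi> i x) \<longlongrightarrow> 1) F"
    and inv: "\<And>s. ((\<lambda>i. LINT x|M. cmod (\<phi> i (- s + x) - \<phi> i x)) \<longlongrightarrow> 0) F"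
  shows "amenable_group M"
proof -
  define n where "n i = (LINT x|M. cmod (\<phi> i x))" for i
  have \<phi>n: "integrable M (\<lambda>x. cmod (\<phi> i x))" for i using \<phi> by (rule integrable_norm)
  have n0: "0 \<le> n i" for i unfolding n_def by (intro integral_nonneg_AE) simp
  have "((\<lambda>i. cmod (LINT x|M. \<phi> i x)) \<longlongrightarrow> 1) F" using tendsto_norm[OF mass] by simp
  then have "\<forall>\<^sub>F i in F. 1/2 < cmod (LINT x|M. \<phi> i x)" by (rule order_tendstoD(1)) simp
  then have nlow: "\<forall>\<^sub>F i in F. 1/2 < n i"
    by eventually_elim (use integral_norm_bound in \<open>auto simp: n_def intro: less_le_trans\<close>)
  have "\<forall>f\<in>Linf M. \<exists>C. AE x in M. \<bar>f x\<bar> \<le> C" unfolding Linf_def by auto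
  then obtain C0 where C0: "\<And>f. f \<in> Linf M \<Longrightarrow> AE x in M. \<bar>f x\<bar> \<le> C0 f" by metis
  \<comment> \<open>Any essential bound will do, since compactness needs just one interval per
    \<open>f\<close>. The maximum with 0 keeps \<open>C f\<close> nonnegative outside
    \<open>Linf M\<close> as well, where \<open>C0 f\<close> is unspecified.\<close>
  define C where "C f = max 0 (C0 f)" for f
  have C: "AE x in M. \<bar>f x\<bar> \<le> C f" if "f \<in> Linf M" for f
    using C0[OF that] by eventually_elim (simp add: C_def)
  have Cn: "0 \<le> C f" for f by (simp add: C_def)
  \<comment> \<open>Defined on all functions, with value 0 outside \<open>Linf M\<close>, so as to
    be a point of the compact product. Division by \<open>n i = 0\<close> also gives 0; eventually
    \<open>n i > 1/2\<close>, so this does not affect the limit.\<close>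
  define \<Lambda> where "\<Lambda> i f = (if f \<in> Linf M then (LINT x|M. f x * cmod (\<phi> i x)) / n i else 0)" for i f
  note fi = integrable_Linf_mult[OF Linf_measurable C \<phi>n]
  have \<Lambda>bd: "\<bar>\<Lambda> i f\<bar> \<le> C f" for i f
  proof (cases "f \<in> Linf M \<and> n i \<noteq> 0")
    case True
    then have "\<bar>LINT x|M. f x * cmod (\<phi> i x)\<bar> \<le> C f * n i" using fi(2)[of f i] by (simp add: n_def)
    then show ?thesis using True n0[of i] by (simp add: \<Lambda>_def abs_div divide_le_eq)
  qed (auto simp: \<Lambda>_def Cn)
  have "filtermap \<Lambda> F \<noteq> bot" using F by (simp add: filtermap_bot_iff)
  moreover have "eventually (\<lambda>\<mu>. \<mu> \<in> {\<mu>. \<forall>f. \<bar>\<mu> f\<bar> \<le> C f}) (filtermap \<Lambda> F)"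
    using \<Lambda>bd by (simp add: eventually_filtermap)
  ultimately obtain \<mu> where \<mu>: "inf (nhds \<mu>) (filtermap \<Lambda> F) \<noteq> bot"
    using compact_bounded_functions[of C] unfolding compact_filter by blast
  \<comment> \<open>The filter \<open>G\<close> replaces a convergent subnet: along it every
    coordinate tends to that of \<open>\<mu>\<close>, and it inherits all properties that hold
    eventually along \<open>F\<close>.\<close>
  define G where "G = inf (nhds \<mu>) (filtermap \<Lambda> F)"
  have Gbot: "G \<noteq> bot" using \<mu> by (simp add: G_def)
  have lim: "((\<lambda>L. L f) \<longlongrightarrow> \<mu> f) G" for f
  proof (rule tendsto_mono)
    show "G \<le> nhds \<mu>" by (simp add: G_def)
    show "((\<lambda>L. L f) \<longlongrightarrow> \<mu> f) (nhds \<mu>)"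
      by (rule continuous_on_tendsto_compose[OF continuous_on_product_coordinates[of f] filterlim_ident]) auto
  qed
  have ev: "eventually P G" if "\<forall>\<^sub>F i in F. P (\<Lambda> i)" for P
    using that filter_leD[of G "filtermap \<Lambda> F" P] by (simp add: G_def eventually_filtermap)
  have lin: "\<mu> (\<lambda>x. f x + k * g x) = \<mu> f + k * \<mu> g" if fg: "f \<in> Linf M" "g \<in> Linf M" for f g k
  proof -
    have "\<Lambda> i (\<lambda>x. f x + k * g x) = \<Lambda> i f + k * \<Lambda> i g" for i
    proof -
      have "(LINT x|M. (f x + k * g x) * cmod (\<phi> i x)) = (LINT x|M. f x * cmod (\<phi> i x) + k * (g x * cmod (\<phi> i x)))"
        by (simp add: distrib_right mult.assoc)
      also have "\<dots> = (LINT x|M. f x * cmod (\<phi> i x)) + k * (LINT x|M. g x * cmod (\<phi> i x))"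
        using fi(1)[OF fg(1) fg(1)] fi(1)[OF fg(2) fg(2)] by simp
      finally show ?thesis using fg Linf_lincomb[OF fg] by (simp add: \<Lambda>_def add_divide_distrib)
    qed
    then have "\<forall>\<^sub>F L in G. L (\<lambda>x. f x + k * g x) = L f + k * L g" by (intro ev always_eventually) auto
    then have "((\<lambda>L. L f + k * L g) \<longlongrightarrow> \<mu> (\<lambda>x. f x + k * g x)) G"
      by (rule Lim_transform_eventually[OF lim])
    moreover have "((\<lambda>L. L f + k * L g) \<longlongrightarrow> \<mu> f + k * \<mu> g) G" by (intro tendsto_intros lim)
    ultimately show ?thesis by (rule tendsto_unique[OF Gbot])
  qed
  have pos: "0 \<le> \<mu> f" if f: "f \<in> Linf M" "AE x in M. 0 \<le> f x" for f
  proof (rule tendsto_lowerbound[OF lim _ Gbot], rule ev, rule always_eventually, rule allI)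
    fix i
    have "0 \<le> (LINT x|M. f x * cmod (\<phi> i x))"
      by (rule integral_nonneg_AE) (use f(2) in \<open>eventually_elim, simp\<close>)
    then show "0 \<le> \<Lambda> i f" using n0 by (simp add: \<Lambda>_def)
  qed
  have one: "\<mu> (\<lambda>x. 1) = 1"
  proof -
    have 1: "(\<lambda>x. 1) \<in> Linf M" unfolding Linf_def by auto
    have "\<forall>\<^sub>F i in F. \<Lambda> i (\<lambda>x. 1) = 1" using nlow by eventually_elim (use 1 in \<open>simp add: \<Lambda>_def n_def\<close>)
    then have "\<forall>\<^sub>F L in G. L (\<lambda>x. 1) = 1" by (rule ev)
    then have "((\<lambda>L. 1) \<longlongrightarrow> \<mu> (\<lambda>x. 1)) G" by (rule Lim_transform_eventually[OF lim])
    then show ?thesis by (rule tendsto_unique[OF Gbot _ tendsto_const])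
  qed
  have tr: "\<mu> (\<lambda>x. f (s + x)) = \<mu> f" if f: "f \<in> Linf M" for f s
  proof -
    let ?fs = "\<lambda>x. f (s + x)"
    let ?d = "\<lambda>i. LINT x|M. cmod (\<phi> i (- s + x) - \<phi> i x)"
    have fs: "?fs \<in> Linf M" by (rule Linf_translate[OF f])
    \<comment> \<open>Left invariance moves the shift from \<open>f\<close> to the density; the
      reverse triangle inequality then compares the moduli through the difference of the functions
      themselves.\<close>
    have bd: "\<bar>\<Lambda> i ?fs - \<Lambda> i f\<bar> \<le> C f * ?d i / n i" for i
    proof -
      have t: "integrable M (\<lambda>x. cmod (\<phi> i (- s + x)))" using integrable_translate[OF \<phi>n[of i], of "- s"] .
      have t2: "integrable M (\<lambda>x. f x * cmod (\<phi> i (- s + x)))"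
        by (rule integrable_Linf_mult(1)[OF Linf_measurable[OF f] C[OF f] t])
      have "(LINT x|M. ?fs x * cmod (\<phi> i x)) = (LINT x|M. f x * cmod (\<phi> i (- s + x)))"
        using integral_translate[OF borel_measurable_integrable[OF t2], of s] by simp
      then have "(LINT x|M. ?fs x * cmod (\<phi> i x)) - (LINT x|M. f x * cmod (\<phi> i x))
          = (LINT x|M. f x * (cmod (\<phi> i (- s + x)) - cmod (\<phi> i x)))"
        using t2 fi(1)[OF f f, of i] by (simp add: right_diff_distrib)
      moreover have "\<bar>LINT x|M. f x * (cmod (\<phi> i (- s + x)) - cmod (\<phi> i x))\<bar>
          \<le> C f * (LINT x|M. \<bar>cmod (\<phi> i (- s + x)) - cmod (\<phi> i x)\<bar>)"
        using t \<phi>n by (intro integrable_Linf_mult(2) Linf_measurable f C) auto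
      moreover have "(LINT x|M. \<bar>cmod (\<phi> i (- s + x)) - cmod (\<phi> i x)\<bar>) \<le> ?d i"
        using t \<phi>n integrable_translate[OF \<phi>[of i], of "- s"] \<phi>[of i]
        by (intro integral_mono norm_triangle_ineq3) auto
      ultimately have "\<bar>(LINT x|M. ?fs x * cmod (\<phi> i x)) - (LINT x|M. f x * cmod (\<phi> i x))\<bar> \<le> C f * ?d i"
        using mult_left_mono[OF _ Cn[of f]] by (smt (verit))
      then have "\<bar>(LINT x|M. ?fs x * cmod (\<phi> i x)) - (LINT x|M. f x * cmod (\<phi> i x))\<bar> / n i \<le> C f * ?d i / n i"
        using n0 by (rule divide_right_mono)
      then show ?thesis using f fs n0[of i] by (simp add: \<Lambda>_def diff_divide_distrib[symmetric] abs_div)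
    qed
    have "((\<lambda>i. \<Lambda> i ?fs - \<Lambda> i f) \<longlongrightarrow> 0) F"
    proof (rule Lim_null_comparison)
      \<comment> \<open>The factor 2 comes from \<open>n i > 1/2\<close>: normalisation at most
        doubles the error.\<close>
      show "\<forall>\<^sub>F i in F. norm (\<Lambda> i ?fs - \<Lambda> i f) \<le> 2 * C f * ?d i"
        using nlow
      proof eventually_elim
        case (elim i)
        have "0 \<le> ?d i" by (intro integral_nonneg_AE) simp
        then have "C f * ?d i / n i \<le> C f * ?d i / (1/2)"
          using elim Cn[of f] by (intro divide_left_mono) auto
        then show ?case using bd[of i] by simp
      qed
      show "((\<lambda>i. 2 * C f * ?d i) \<longlongrightarrow> 0) F" using tendsto_mult_right_zero[OF inv[of s], of "2 * C f"] by simp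
    qed
    then have "((\<lambda>L. L ?fs - L f) \<longlongrightarrow> 0) (filtermap \<Lambda> F)" by (simp add: filterlim_filtermap)
    then have "((\<lambda>L. L ?fs - L f) \<longlongrightarrow> 0) G" by (rule tendsto_mono[rotated]) (simp add: G_def)
    moreover have "((\<lambda>L. L ?fs - L f) \<longlongrightarrow> \<mu> ?fs - \<mu> f) G" by (intro tendsto_intros lim)
    ultimately have "\<mu> ?fs - \<mu> f = 0" using tendsto_unique[OF Gbot] by blast
    then show ?thesis by simp
  qed
  show ?thesis unfolding amenable_group_def using lin pos one tr by (intro exI[of _ \<mu>]) blast
qed

end

theorem theorem3p2:
  fixes M :: "'g::{topological_group_add,t2_space} measure"
    and w :: "'g \<Rightarrow> real"
    and F :: "'i filter"
    and m :: "'i \<Rightarrow> nat \<Rightarrow> ('g \<Rightarrow> complex) \<times> ('g \<Rightarrow> complex)"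
  assumes "locally_compact_space (euclidean :: 'g topology)"
    and "left_haar_measure M"
    and "is_weight w"
    and "\<exists>c>0. \<forall>x. c \<le> w x"
    and "approx_diagonal M w F m"
  shows "amenable_group M"
proof -
  from assms(4) obtain c where c: "c > 0" "\<And>x. c \<le> w x" by blast
  interpret weighted_haar_group M w c
    using assms(1-3) c by unfold_locales
  have "F \<noteq> bot" using assms(5) unfolding approx_diagonal_def by blast
  with approx_diagonal_imp_almost_invariant[OF assms(5)] show ?thesis
    using almost_invariant_imp_amenable by blast
qed

end
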